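(* Let $(\mathcal A,m_{\mathcal A})$, $(\mathcal B,m_{\mathcal B})$, $(\mathcal C,m_{\mathcal C})$ be $A_\infty$-categories and $\Phi_0:\mathcal O_{\mathcal A}\to\mathcal O_{\mathcal B}$, $\Psi_0:\mathcal O_{\mathcal C}\to\mathcal O_{\mathcal A}$ maps. If $(\Phi_0,f),(\Phi_0,g):(\mathcal A,m_{\mathcal A})\to(\mathcal B,m_{\mathcal B})$ are homotopic $A_\infty$-morphisms and $(\Psi_0,h):(\mathcal C,m_{\mathcal C})\to(\mathcal A,m_{\mathcal A})$ is an $A_\infty$-morphism, then $(\Phi_0\circ\Psi_0,f\circ h)$ and $(\Phi_0\circ\Psi_0,g\circ h)$ are homotopic.
   Context: Conventions. $\Bbbk$ is a field of characteristic different from $2$ and $3$. Graded spaces are $\mathbb Z$-graded, $V[n]^i=V^{n+i}$. $\mathcal Hom$ is the graded space of maps of all degrees, products are graded products, and the Koszul sign rule is used. For a graded space $V$, $V[t]$ is the space of polynomials in $t$ with coefficients in $V$. A graded quiver $\mathcal A$ with object set $\mathcal O_{\mathcal A}$ is a family of graded spaces ${}_x\mathcal A_y$; for $\bar x=(x_1,\dots,x_p)$, $\mathcal A[1]^{\otimes\bar x}={}_{x_1}\mathcal A_{x_2}[1]\otimes\cdots\otimes{}_{x_{p-1}}\mathcal A_{x_p}[1]$. For $\Phi_0:\mathcal O_{\mathcal A}\to\mathcal O_{\mathcal B}$ let $C_{\Phi_0}(\mathcal A,\mathcal B)[1]=\prod_{p\ge2}\prod_{\bar x\in\mathcal O_{\mathcal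 A}^p}\mathcal Hom(\mathcal A[1]^{\otimes\bar x},{}_{\Phi_0(x_1)}\mathcal B_{\Phi_0(x_p)}[1])$ and $C(\mathcal A)[1]=C_{\mathrm{id}}(\mathcal A,\mathcal A)[1]$. For $f\in C_{\Phi_0}(\mathcal A,\mathcal B)[1]$, $m\in C(\mathcal A)[1]$, $(f\circ_Gm)^{\bar x}=\sum f(\mathrm{id}^{\otimes}\otimes m\otimes\mathrm{id}^{\otimes})$ (all insertions). For $k\in C_{\Phi_0}(\mathcal A,\mathcal B)[1]$ and $h_j\in C_{\Psi_0}(\mathcal C,\mathcal A)[1]$, $k(h_1,\dots,h_r)^{\bar x}=\sum k\circ(h_1\otimes\cdots\otimes h_r)$ over all decompositions of $\bar x$ into $r$ consecutive pieces, using the component of $k$ with $r$ inputs; $k\circ h=\sum_{r\ge1}k(h,\dots,h)$. The same notation is used for elements of $C(\mathcal B)[1]$ applied to elements of $C_{\Phi_0}(\mathcal A,\mathcal B)[1]$. An $A_\infty$-structure on $\mathcal A$ is $m_{\mathcal A}\in C(\mathcal A)[1]$ of degree $1$ with $m_{\mathcal A}\circ_Gm_{\mathcal A}=0$; an $A_\infty$-category is a graded quiver with such a structure. An $A_\infty$-morphism $(\Phi_0,f):(\mathcal A,m_{\mathcal A})\to(\mathcal B,m_{\mathcal B})$ is $f\in C_{\Phi_0}(\mathcal A,\mathcal B)[1]$ of degree $0$ with $f\circ_Gm_{\mathcal A}=\sum_{r\ge1}m_{\mathcal B}(f,\dots,f)$. Homotopy. Two $A_\infty$-morphisms $(\Phi_0,f),(\Phi_0,g):(\mathcal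 A,m_{\mathcal A})\to(\mathcal B,m_{\mathcal B})$ are homotopic if there are $a(t)$ (degree $0$) and $b(t)$ (degree $-1$) in $C_{\Phi_0}(\mathcal A,\mathcal B)[1][t]$ with $a(0)=f$, $a(1)=g$, $(\Phi_0,a(t))$ an $A_\infty$-morphism $(\mathcal A,m_{\mathcal A})\to(\mathcal B,m_{\mathcal B})$ for all $t\in\Bbbk$ and, for all $t\in\Bbbk$, $\frac{\partial a}{\partial t}=\sum_{r\ge1}\sum_{j=1}^rm_{\mathcal B}(a,\dots,\underset{j}{b},\dots,a)+b\circ_Gm_{\mathcal A}$. *)

theory Defs
  imports
    "HOL-Computational_Algebra.Polynomial"
    "HOL-Library.Function_Algebras"
    "HOL-Library.FuncSet"
begin

text \<open>
  The graded pieces of all the spaces of morphisms of a quiver are subspaces of one ambient vector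
  space. The pieces need not be independent or even distinct (every family of vector spaces arises
  in this way, e.g. inside its direct sum); the degree of an element is therefore always recorded
  separately, and a homogeneous element is a pair of its degree and its underlying vector.
\<close>

record ('k, 'o, 'v) quiver =
  objs :: "'o set"
  hom :: "'o \<Rightarrow> 'o \<Rightarrow> int \<Rightarrow> 'v set"
  scl :: "'k \<Rightarrow> 'v \<Rightarrow> 'v"

definition graded_quiver :: "('k::field, 'o, 'v::ab_group_add) quiver \<Rightarrow> bool" where
  "graded_quiver A \<longleftrightarrow>
     vector_space (scl A) \<and>
     (\<forall>x\<in>objs A. \<forall>y\<in>objs A. \<forall>i. module.subspace (scl A) (hom A x y i))"

definition shift :: "int \<Rightarrow> (int \<Rightarrow> 'v set) \<Rightarrow> int \<Rightarrow> 'v set" where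
  "shift n V i = V (n + i)"

text \<open>
  \<open>tensors A xs\<close> are the elementary homogeneous tensors \<open>v\<^sub>1 \<otimes> \<dots> \<otimes> v\<^sub>n\<close> of
  \<open>A[1]\<^sup>\<otimes>\<^sup>x\<close>, for \<open>x = (x\<^sub>1, \<dots>, x\<^sub>n\<^sub>+\<^sub>1)\<close> with \<open>n \<ge> 1\<close>. All degrees are those of \<open>A[1]\<close>.
\<close>

definition tensors ::
  "('k, 'o, 'v) quiver \<Rightarrow> 'o list \<Rightarrow> (int \<times> 'v) list set" where
  "tensors A xs = {vs. vs \<noteq> [] \<and> length xs = Suc (length vs) \<and> set xs \<subseteq> objs A \<and>
     (\<forall>i<length vs. snd (vs ! i) \<in> shift 1 (hom A (xs ! i) (xs ! Suc i)) (fst (vs ! i)))}"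

abbreviation deg :: "(int \<times> 'v) list \<Rightarrow> int" where
  "deg vs \<equiv> sum_list (map fst vs)"

text \<open>
  A linear map of degree \<open>d\<close> on \<open>A[1]\<^sup>\<otimes>\<^sup>x\<close> is a family, indexed by the degrees of the tensor
  factors, of multilinear maps raising the total degree by \<open>d\<close>. A family of such maps over all
  \<open>x\<close> is a function of \<open>x\<close> and of the homogeneous arguments; extending it by zero outside
  \<^const>\<open>tensors\<close> makes equality of families equality of functions. \<open>cochains A B \<Phi> d\<close> is the
  degree \<open>d\<close> part of \<open>C\<^sub>\<Phi>(A,B)[1]\<close>.
\<close>

type_synonym ('o, 'v, 'w) cochain = "'o list \<Rightarrow> (int \<times> 'v) list \<Rightarrow> 'w"

definition cochains ::
  "('k::field, 'a, 'v::ab_group_add) quiver \<Rightarrow> ('k, 'b, 'w::ab_group_add) quiver \<Rightarrow>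
   ('a \<Rightarrow> 'b) \<Rightarrow> int \<Rightarrow> ('a, 'v, 'w) cochain set" where
  "cochains A B \<Phi> d = {f.
     (\<forall>xs vs. vs \<notin> tensors A xs \<longrightarrow> f xs vs = 0) \<and>
     (\<forall>xs. \<forall>vs\<in>tensors A xs.
        f xs vs \<in> shift 1 (hom B (\<Phi> (hd xs)) (\<Phi> (last xs))) (d + deg vs)) \<and>
     (\<forall>xs. \<forall>vs\<in>tensors A xs. \<forall>i<length vs.
        \<forall>v\<in>shift 1 (hom A (xs ! i) (xs ! Suc i)) (fst (vs ! i)).
        \<forall>w\<in>shift 1 (hom A (xs ! i) (xs ! Suc i)) (fst (vs ! i)). \<forall>c.
          f xs (vs[i := (fst (vs ! i), v + w)]) =
            f xs (vs[i := (fst (vs ! i), v)]) + f xs (vs[i := (fst (vs ! i), w)]) \<and>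
          f xs (vs[i := (fst (vs ! i), scl A c v)]) =
            scl B c (f xs (vs[i := (fst (vs ! i), v)])))}"

definition signed :: "int \<Rightarrow> 'w::ab_group_add \<Rightarrow> 'w" where
  "signed e w = (if even e then w else - w)"

definition seg :: "nat \<Rightarrow> nat \<Rightarrow> 'x list \<Rightarrow> 'x list" where
  "seg i j xs = take (j - i) (drop i xs)"

text \<open>
  In the operations below, elements of \<^const>\<open>cochains\<close> come paired with their degree wherever it
  enters a Koszul sign or the degree of an output.

  \<open>gerst A f (e, m)\<close> is \<open>f \<circ>\<^sub>G m\<close>: for \<open>i < j\<close>, the map \<open>m\<close> is applied to
  \<open>v\<^sub>i\<^sub>+\<^sub>1, \<dots>, v\<^sub>j\<close>, after having been moved past \<open>v\<^sub>1, \<dots>, v\<^sub>i\<close>.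
\<close>

definition gerst ::
  "('k, 'a, 'v) quiver \<Rightarrow> ('a, 'v, 'w::ab_group_add) cochain \<Rightarrow>
   int \<times> ('a, 'v, 'v) cochain \<Rightarrow> ('a, 'v, 'w) cochain" where
  "gerst A f em = (\<lambda>xs vs. if vs \<in> tensors A xs then
     (\<Sum>i<length vs. \<Sum>j\<in>{i<..length vs}.
        signed (fst em * deg (take i vs))
          (f (take (Suc i) xs @ drop j xs)
             (take i vs @
              [(fst em + deg (seg i j vs), snd em (seg i (Suc j) xs) (seg i j vs))] @
              drop j vs)))
     else 0)"

text \<open>
  A decomposition of \<open>n\<close> inputs into \<open>r\<close> consecutive nonempty pieces, given by its cut points
  \<open>0 = p\<^sub>0 < p\<^sub>1 < \<dots> < p\<^sub>r = n\<close>. The corresponding pieces of the tuple of objects share their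
  end points.
\<close>

definition cuts :: "nat \<Rightarrow> nat \<Rightarrow> nat list set" where
  "cuts n r = {ps. length ps = Suc r \<and> sorted_wrt (<) ps \<and> hd ps = 0 \<and> last ps = n}"

lemma finite_cuts: "finite (cuts n r)"
proof (rule finite_subset)
  show "cuts n r \<subseteq> {ps. set ps \<subseteq> {..n} \<and> length ps = Suc r}"
  proof clarify
    fix ps assume ps: "ps \<in> cuts n r"
    then have s: "sorted ps" and l: "last ps = n" and len: "length ps = Suc r"
      by (auto simp: cuts_def strict_sorted_imp_sorted)
    have "x \<le> n" if "x \<in> set ps" for x
    proof -
      from that obtain i where "i < length ps" "x = ps ! i"
        by (auto simp: in_set_conv_nth)
      moreover have "last ps = ps ! r" using len by (subst last_conv_nth) auto
      ultimately show ?thesis using s l len by (auto simp: sorted_iff_nth_mono)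
    qed
    with len show "set ps \<subseteq> {..n} \<and> length ps = Suc r" by auto
  qed
qed (simp add: finite_lists_length_eq)

text \<open>
  \<open>brace C \<Psi> k [(e\<^sub>1, h\<^sub>1), \<dots>, (e\<^sub>r, h\<^sub>r)]\<close> is \<open>k(h\<^sub>1, \<dots>, h\<^sub>r)\<close>, where the \<open>h\<^sub>j\<close> are defined on
  the quiver \<open>C\<close> and lie over the map of objects \<open>\<Psi>\<close>. The sign comes from moving each \<open>h\<^sub>j\<close> past
  the inputs preceding its own.
\<close>

definition brace ::
  "('k, 'c, 'u) quiver \<Rightarrow> ('c \<Rightarrow> 'a) \<Rightarrow> ('a, 'v, 'w::ab_group_add) cochain \<Rightarrow>
   (int \<times> ('c, 'u, 'v) cochain) list \<Rightarrow> ('c, 'u, 'w) cochain" where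
  "brace C \<Psi> k hs = (\<lambda>xs vs. if vs \<in> tensors C xs then
     (\<Sum>ps\<in>cuts (length vs) (length hs).
        signed (\<Sum>j<length hs. fst (hs ! j) * deg (take (ps ! j) vs))
          (k (map (\<lambda>p. \<Psi> (xs ! p)) ps)
             (map (\<lambda>j. let ys = seg (ps ! j) (Suc (ps ! Suc j)) xs;
                           ws = seg (ps ! j) (ps ! Suc j) vs
                       in (fst (hs ! j) + deg ws, snd (hs ! j) ys ws))
                [0..<length hs])))
     else 0)"

text \<open>
  \<open>k \<circ> h = \<Sum>\<^sub>r\<^sub>\<ge>\<^sub>1 k(h, \<dots>, h)\<close>. On \<open>n\<close> inputs the terms with \<open>r > n\<close> vanish, there being no
  decompositions into that many pieces; the same applies to the sum in \<open>homotopic\<close>.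
\<close>

definition comp_cochain ::
  "('k, 'c, 'u) quiver \<Rightarrow> ('c \<Rightarrow> 'a) \<Rightarrow> ('a, 'v, 'w::ab_group_add) cochain \<Rightarrow>
   int \<times> ('c, 'u, 'v) cochain \<Rightarrow> ('c, 'u, 'w) cochain" where
  "comp_cochain C \<Psi> k h = (\<lambda>xs vs. \<Sum>r=1..length vs. brace C \<Psi> k (replicate r h) xs vs)"

definition ainf_category ::
  "('k::field, 'a, 'v::ab_group_add) quiver \<Rightarrow> ('a, 'v, 'v) cochain \<Rightarrow> bool" where
  "ainf_category A m \<longleftrightarrow>
     graded_quiver A \<and> m \<in> cochains A A id 1 \<and> gerst A m (1, m) = 0"

definition ainf_morphism ::
  "('k::field, 'a, 'v::ab_group_add) quiver \<Rightarrow> ('a, 'v, 'v) cochain \<Rightarrow>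
   ('k, 'b, 'w::ab_group_add) quiver \<Rightarrow> ('b, 'w, 'w) cochain \<Rightarrow>
   ('a \<Rightarrow> 'b) \<Rightarrow> ('a, 'v, 'w) cochain \<Rightarrow> bool" where
  "ainf_morphism A mA B mB \<Phi> f \<longleftrightarrow>
     \<Phi> \<in> objs A \<rightarrow> objs B \<and> f \<in> cochains A B \<Phi> 0 \<and>
     gerst A f (1, mA) = comp_cochain A \<Phi> mB (0, f)"

text \<open>
  The space \<open>V[t]\<close> for a space \<open>V\<close> of cochains, and the values at \<open>t\<close> of such a polynomial and of
  its formal derivative. The type of polynomials only supplies the coefficient sequences of finite
  support; there is no multiplication of coefficients.
\<close>

definition polys :: "'x::zero set \<Rightarrow> 'x poly set" where
  "polys V = {p. \<forall>i. coeff p i \<in> V}"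

definition eval_poly ::
  "('k::field, 'b, 'w::ab_group_add) quiver \<Rightarrow> ('a, 'v, 'w) cochain poly \<Rightarrow> 'k \<Rightarrow>
   ('a, 'v, 'w) cochain" where
  "eval_poly B p t = (\<lambda>xs vs. \<Sum>i\<le>degree p. scl B (t ^ i) (coeff p i xs vs))"

definition eval_deriv ::
  "('k::field, 'b, 'w::ab_group_add) quiver \<Rightarrow> ('a, 'v, 'w) cochain poly \<Rightarrow> 'k \<Rightarrow>
   ('a, 'v, 'w) cochain" where
  "eval_deriv B p t =
     (\<lambda>xs vs. \<Sum>i<degree p. scl B (of_nat (Suc i) * t ^ i) (coeff p (Suc i) xs vs))"

definition homotopic ::
  "('k::field, 'a, 'v::ab_group_add) quiver \<Rightarrow> ('a, 'v, 'v) cochain \<Rightarrow>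
   ('k, 'b, 'w::ab_group_add) quiver \<Rightarrow> ('b, 'w, 'w) cochain \<Rightarrow>
   ('a \<Rightarrow> 'b) \<Rightarrow> ('a, 'v, 'w) cochain \<Rightarrow> ('a, 'v, 'w) cochain \<Rightarrow> bool" where
  "homotopic A mA B mB \<Phi> f g \<longleftrightarrow>
     ainf_morphism A mA B mB \<Phi> f \<and> ainf_morphism A mA B mB \<Phi> g \<and>
     (\<exists>a\<in>polys (cochains A B \<Phi> 0). \<exists>b\<in>polys (cochains A B \<Phi> (-1)).
        eval_poly B a 0 = f \<and> eval_poly B a 1 = g \<and>
        (\<forall>t. ainf_morphism A mA B mB \<Phi> (eval_poly B a t)) \<and>
        (\<forall>t. eval_deriv B a t =
           (\<lambda>xs vs. \<Sum>r=1..length vs. \<Sum>j=1..r.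
              brace A \<Phi> mB
                (replicate (j - 1) (0, eval_poly B a t) @ [(-1, eval_poly B b t)] @
                 replicate (r - j) (0, eval_poly B a t)) xs vs) +
           gerst A (eval_poly B b t) (1, mA)))"

end

theory Submission
  imports Defs
begin

text \<open>
  Precomposition with \<open>h\<close> is linear and compatible with all the operations: since \<open>h\<close> has degree
  \<open>0\<close> no new Koszul signs appear, \<open>m(k\<^sub>1, \<dots>, k\<^sub>r) \<circ> h = m(k\<^sub>1 \<circ> h, \<dots>, k\<^sub>r \<circ> h)\<close>, and, because
  \<open>h \<circ>\<^sub>G m\<^sub>C = m\<^sub>A \<circ> h\<close>, also \<open>(k \<circ> h) \<circ>\<^sub>G m\<^sub>C = (k \<circ>\<^sub>G m\<^sub>A) \<circ> h\<close> for every cochain \<open>k\<close>. Hence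
  applying \<open>_ \<circ> h\<close> to the coefficients of a homotopy \<open>(a(t), b(t))\<close> from \<open>f\<close> to \<open>g\<close> gives a homotopy
  from \<open>f \<circ> h\<close> to \<open>g \<circ> h\<close>.
\<close>

section \<open>Tensors as paths of arrows\<close>

text \<open>Both identities behind the overview compare nested sums: one side decomposes a tensor
  and then operates on the results, the other operates first and decomposes afterwards. They become
  exchanges of summation once both sides are indexed by the same nested decompositions. For an
  inserted \<open>mC\<close> the common index is an outer decomposition with one block
  \<open>Q\<close> singled out; on that block the equation of \<open>h\<close> is used, and
  additivity of \<open>k\<close> in a single slot suffices. For braces the common index is a
  decomposition into blocks of blocks, and all slots have to be expanded at once. The obstacle is
  that additivity holds only for entries of the right morphism spaces, since a cochain is zero by
  convention on everything else. Hence the expansions come with proofs that the tuples concerned are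
  paths. The degree of the outer cochain enters neither identity, so the one for \<open>mC\<close>
  serves b(t) in degree -1 as well as a(t) in degree 0.\<close>

text \<open>
  An elementary tensor together with its tuple of objects is encoded as a list of composable arrows
  (source, (degree in \<open>A[1]\<close>, vector), target). Decompositions of a tensor into consecutive pieces
  are then decompositions of a list as a concatenation, which are free of index arithmetic.
\<close>

type_synonym ('o, 'v) arrow = "'o \<times> (int \<times> 'v) \<times> 'o"

abbreviation src :: "('o, 'v) arrow \<Rightarrow> 'o" where "src \<equiv> fst"
abbreviation tgt :: "('o, 'v) arrow \<Rightarrow> 'o" where "tgt a \<equiv> snd (snd a)"
abbreviation elt :: "('o, 'v) arrow \<Rightarrow> int \<times> 'v" where "elt a \<equiv> fst (snd a)"

definition arrows :: "('k, 'o, 'v) quiver \<Rightarrow> ('o, 'v) arrow set" where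
  "arrows A = {(x, (d, v), y). x \<in> objs A \<and> y \<in> objs A \<and> v \<in> hom A x y (1 + d)}"

definition path :: "('k, 'o, 'v) quiver \<Rightarrow> ('o, 'v) arrow list \<Rightarrow> bool" where
  "path A as \<longleftrightarrow> as \<noteq> [] \<and> set as \<subseteq> arrows A \<and> successively (\<lambda>a b. tgt a = src b) as"

definition pdeg :: "('o, 'v) arrow list \<Rightarrow> int" where
  "pdeg as = deg (map elt as)"

text \<open>
  \<open>app f as\<close> is the value of \<open>f\<close> on a path, and \<open>hat\<close> below turns such a value into an input of
  the next operation.
\<close>

definition app :: "('o, 'v, 'w) cochain \<Rightarrow> ('o, 'v) arrow list \<Rightarrow> 'w" where
  "app f as = f (map src as @ [tgt (last as)]) (map elt as)"

text \<open>\<open>zip\<close> truncates, so the last object survives only as a target. One object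
  without inputs would be lost, but tensors are nonempty.\<close>

definition arr :: "'o list \<Rightarrow> (int \<times> 'v) list \<Rightarrow> ('o, 'v) arrow list" where
  "arr xs vs = zip xs (zip vs (tl xs))"

definition hat :: "('c \<Rightarrow> 'a) \<Rightarrow> int \<times> ('c, 'u, 'v) cochain \<Rightarrow> ('c, 'u) arrow list \<Rightarrow> ('a, 'v) arrow"
  where "hat \<Psi> h as = (\<Psi> (src (hd as)), (fst h + pdeg as, app (snd h) as), \<Psi> (tgt (last as)))"

text \<open>No number of blocks is prescribed. Excluding empty blocks matches strictly increasing
  cut points and keeps the set finite.\<close>

definition decs :: "'x list \<Rightarrow> 'x list list set" where
  "decs as = {pss. [] \<notin> set pss \<and> concat pss = as}"

text \<open>\<open>ws\<close> is the nonempty stretch of inputs consumed by an inserted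
  operation.\<close>

definition splits :: "'x list \<Rightarrow> ('x list \<times> 'x list \<times> 'x list) set" where
  "splits as = {(us, ws, zs). ws \<noteq> [] \<and> us @ ws @ zs = as}"

lemma pdeg_simps [simp]:
  "pdeg [] = 0" "pdeg (a # as) = fst (elt a) + pdeg as" "pdeg (as @ bs) = pdeg as + pdeg bs"
  by (simp_all add: pdeg_def)

lemma signed_simps [simp]:
  "signed 0 w = w" "signed e 0 = 0" "signed e (signed e' w) = signed (e + e') w"
  by (simp_all add: signed_def)

lemma signed_sum: "signed e (\<Sum>i\<in>I. w i) = (\<Sum>i\<in>I. signed e (w i))"
  by (simp add: signed_def sum_negf)

lemma src_hat [simp]: "src (hat \<Psi> h as) = \<Psi> (src (hd as))"
  and tgt_hat [simp]: "tgt (hat \<Psi> h as) = \<Psi> (tgt (last as))"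
  and elt_hat: "elt (hat \<Psi> h as) = (fst h + pdeg as, app (snd h) as)"
  by (simp_all add: hat_def)

text \<open>Since \<open>h\<close> has degree 0, replacing blocks by their values preserves total
  degree; this is why signs computed before and after applying \<open>h\<close> agree.\<close>

lemma pdeg_map_hat: "pdeg (map (hat \<Psi> (0, h)) pss) = pdeg (concat pss)"
  by (induction pss) (simp_all add: elt_hat)

lemma length_arr: "length xs = Suc (length vs) \<Longrightarrow> length (arr xs vs) = length vs"
  by (simp add: arr_def)

lemma nth_arr:
  "length xs = Suc (length vs) \<Longrightarrow> i < length vs \<Longrightarrow> arr xs vs ! i = (xs ! i, vs ! i, xs ! Suc i)"
  by (simp add: arr_def nth_tl)

lemma elt_arr: "length xs = Suc (length vs) \<Longrightarrow> map elt (arr xs vs) = vs"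
  by (rule nth_equalityI) (simp_all add: length_arr nth_arr)

lemma objs_arr:
  assumes "length xs = Suc (length vs)" "vs \<noteq> []"
  shows "map src (arr xs vs) @ [tgt (last (arr xs vs))] = xs"
proof (rule nth_equalityI)
  have ne: "arr xs vs \<noteq> []" using assms by (metis length_arr length_0_conv)
  fix i assume "i < length (map src (arr xs vs) @ [tgt (last (arr xs vs))])"
  then have "i < length vs \<or> i = length vs" using assms by (auto simp: length_arr)
  then show "(map src (arr xs vs) @ [tgt (last (arr xs vs))]) ! i = xs ! i"
    using assms ne by (auto simp: nth_append length_arr nth_arr last_conv_nth)
qed (use assms in \<open>simp add: length_arr\<close>)

lemma app_arr: "length xs = Suc (length vs) \<Longrightarrow> vs \<noteq> [] \<Longrightarrow> app f (arr xs vs) = f xs vs"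
  by (simp add: app_def objs_arr elt_arr)

lemma pdeg_arr: "length xs = Suc (length vs) \<Longrightarrow> pdeg (arr xs vs) = deg vs"
  by (simp add: pdeg_def elt_arr)

lemma arr_path: "successively (\<lambda>a b. tgt a = src b) as \<Longrightarrow>
    arr (map src as @ [tgt (last as)]) (map elt as) = as"
proof (cases "as = []")
  case False
  assume s: "successively (\<lambda>a b. tgt a = src b) as"
  show ?thesis
  proof (rule nth_equalityI)
    fix i assume "i < length (arr (map src as @ [tgt (last as)]) (map elt as))"
    then have i: "i < length as" by (simp add: length_arr)
    have "(map src as @ [tgt (last as)]) ! Suc i = tgt (as ! i)"
    proof (cases "Suc i < length as")
      case True
      then show ?thesis using s by (simp add: nth_append successively_conv_nth)
    next
      case F: False
      with i have "Suc i = length as" by simp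
      then show ?thesis using False by (simp add: nth_append last_conv_nth flip: \<open>Suc i = length as\<close>)
    qed
    then show "arr (map src as @ [tgt (last as)]) (map elt as) ! i = as ! i"
      using i by (simp add: nth_arr nth_append)
  qed (simp add: length_arr)
qed (simp add: arr_def)

text \<open>The length condition has to be stated separately: \<open>arr\<close> truncates, so lists
  of unmatched lengths may give a path too.\<close>

lemma tensors_iff_path: "vs \<in> tensors A xs \<longleftrightarrow> length xs = Suc (length vs) \<and> path A (arr xs vs)"
proof (cases "length xs = Suc (length vs) \<and> vs \<noteq> []")
  case True
  then have l: "length xs = Suc (length vs)" and ne: "arr xs vs \<noteq> []"
    using length_arr[of xs vs] by auto
  have s: "successively (\<lambda>a b. tgt a = src b) (arr xs vs)"
    using l by (simp add: successively_conv_nth length_arr nth_arr)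
  have "vs \<in> tensors A xs \<longleftrightarrow>
    (\<forall>i<length xs. xs ! i \<in> objs A) \<and>
    (\<forall>i<length vs. snd (vs ! i) \<in> hom A (xs ! i) (xs ! Suc i) (1 + fst (vs ! i)))"
    using True by (auto simp: tensors_def shift_def subset_iff in_set_conv_nth)
  moreover have "(\<forall>i<length xs. xs ! i \<in> objs A) \<longleftrightarrow>
      (\<forall>i<length vs. xs ! i \<in> objs A \<and> xs ! Suc i \<in> objs A)" (is "?L \<longleftrightarrow> ?R")
  proof
    assume R: ?R
    show ?L
    proof (intro allI impI)
      fix i assume "i < length xs"
      \<comment> \<open>Object 0 is the source of the first arrow, which exists because
        \<open>vs\<close> is nonempty; every later object is a target.\<close>
      then show "xs ! i \<in> objs A" using R True by (cases i) auto
    qed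
  qed (use l in auto)
  ultimately have "vs \<in> tensors A xs \<longleftrightarrow> (\<forall>i<length vs. arr xs vs ! i \<in> arrows A)"
    using l by (auto simp: arrows_def nth_arr case_prod_beta)
  also have "\<dots> \<longleftrightarrow> set (arr xs vs) \<subseteq> arrows A"
    using l by (simp add: subset_eq all_set_conv_all_nth length_arr)
  finally show ?thesis using l s ne by (simp add: path_def)
next
  case False
  then show ?thesis by (auto simp: tensors_def path_def arr_def)
qed

lemma path_tensors:
  assumes "path A as"
  obtains xs vs where "vs \<in> tensors A xs" "as = arr xs vs" "length xs = Suc (length vs)" "vs \<noteq> []"
proof -
  let ?xs = "map src as @ [tgt (last as)]" and ?vs = "map elt as"
  have *: "arr ?xs ?vs = as" using assms by (simp add: arr_path path_def)
  then have "?vs \<in> tensors A ?xs" using assms by (simp add: tensors_iff_path)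
  moreover have "?vs \<noteq> []" using assms by (simp add: path_def)
  ultimately show ?thesis using that[of ?vs ?xs] * by simp
qed

text \<open>With the default value 0 outside \<open>tensors\<close>, equality of functions is a
  matter of paths alone; all identities between operations below are proved through this
  rule.\<close>

lemma cochain_eqI:
  assumes "\<And>xs vs. vs \<notin> tensors A xs \<Longrightarrow> f xs vs = 0" "\<And>xs vs. vs \<notin> tensors A xs \<Longrightarrow> g xs vs = 0"
    and "\<And>as. path A as \<Longrightarrow> app f as = app g as"
  shows "f = g"
proof (intro ext)
  fix xs vs
  show "f xs vs = g xs vs"
  proof (cases "vs \<in> tensors A xs")
    case True
    then have "length xs = Suc (length vs)" "vs \<noteq> []" "path A (arr xs vs)"
      by (auto simp: tensors_iff_path path_def arr_def)
    then show ?thesis using assms(3)[of "arr xs vs"] by (simp add: app_arr)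
  qed (simp add: assms)
qed

lemma path_append:
  "us \<noteq> [] \<Longrightarrow> zs \<noteq> [] \<Longrightarrow>
    path A (us @ zs) \<longleftrightarrow> path A us \<and> path A zs \<and> tgt (last us) = src (hd zs)"
  by (auto simp: path_def successively_append_iff)

lemma path_single: "path A [a] \<longleftrightarrow> a \<in> arrows A"
  by (simp add: path_def)

text \<open>Neighbouring arrows see only the two end objects of a block.\<close>

lemma path_replace:
  assumes "path A (us @ ws @ zs)" "ws \<noteq> []" "path A ws'" "src (hd ws') = src (hd ws)"
    "tgt (last ws') = tgt (last ws)"
  shows "path A (us @ ws' @ zs)"
proof -
  have "ws' \<noteq> []" using assms(3) by (simp add: path_def)
  with assms show ?thesis by (cases "us = []"; cases "zs = []") (auto simp: path_append)
qed

text \<open>Each label carries a block \<open>\<pi> l\<close> and the arrow \<open>\<eta> l\<close>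
  computed from it. Labels are needed because in a brace different blocks are fed to different
  cochains; plain blocks are the case \<open>\<pi> = id\<close>.\<close>

lemma path_map:
  assumes \<eta>: "\<And>l. l \<in> set ls \<Longrightarrow> path C (\<pi> l) \<Longrightarrow>
      \<eta> l \<in> arrows A \<and> src (\<eta> l) = \<Psi> (src (hd (\<pi> l))) \<and> tgt (\<eta> l) = \<Psi> (tgt (last (\<pi> l)))"
    and "path C (concat (map \<pi> ls))" "\<And>l. l \<in> set ls \<Longrightarrow> \<pi> l \<noteq> []"
  shows "path A (map \<eta> ls)"
  using assms
proof (induction ls)
  case Nil
  then show ?case by (simp add: path_def)
next
  case (Cons p ls)
  show ?case
  proof (cases ls)
    case Nil
    then show ?thesis using Cons.prems by (simp add: path_single)
  next
    case (Cons q qs)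
    have ne: "\<pi> p \<noteq> []" "concat (map \<pi> ls) \<noteq> []" using Cons.prems(3) Cons by auto
    then have *: "path C (\<pi> p)" "path C (concat (map \<pi> ls))"
        "tgt (last (\<pi> p)) = src (hd (concat (map \<pi> ls)))"
      using Cons.prems(2) by (auto simp: path_append)
    have hd: "hd (concat (map \<pi> ls)) = hd (\<pi> q)" using Cons Cons.prems(3) by simp
    have "path C (\<pi> q)"
    proof (cases "concat (map \<pi> qs) = []")
      case True
      with *(2) Cons show ?thesis by (simp del: concat_eq_Nil_conv)
    next
      case False
      with *(2) Cons Cons.prems(3) show ?thesis by (simp add: path_append del: concat_eq_Nil_conv)
    qed
    then have "src (\<eta> q) = \<Psi> (src (hd (\<pi> q)))" using Cons.prems(1) Cons by simp
    moreover have "path A (map \<eta> ls)" using Cons.IH Cons.prems *(2) by simp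
    moreover have "\<eta> p \<in> arrows A" "tgt (\<eta> p) = \<Psi> (tgt (last (\<pi> p)))"
      using Cons.prems(1)[of p] *(1) by simp_all
    ultimately have "path A ([\<eta> p] @ map \<eta> ls)"
      using *(3) hd Cons by (subst path_append) (simp_all add: path_single)
    then show ?thesis by simp
  qed
qed

section \<open>Reindexing sums over decompositions of lists\<close>

lemma neq_Nil_concat: "[] \<notin> set pss \<Longrightarrow> (\<forall>p\<in>set pss. p = []) \<longleftrightarrow> pss = []"
  by (cases pss) auto

lemma length_le_length_concat: "[] \<notin> set pss \<Longrightarrow> length pss \<le> length (concat pss)"
proof (induction pss)
  case (Cons p pss)
  then show ?case by (cases p) auto
qed simp

lemma length_decs: "pss \<in> decs as \<Longrightarrow> length pss \<le> length as"
  using length_le_length_concat by (auto simp: decs_def)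

lemma finite_decs [simp]: "finite (decs as)"
proof (rule finite_subset)
  let ?P = "{p. set p \<subseteq> set as \<and> length p \<le> length as}"
  show "decs as \<subseteq> {pss. set pss \<subseteq> ?P \<and> length pss \<le> length as}"
  proof
    fix pss assume pss: "pss \<in> decs as"
    then have c: "concat pss = as" by (simp add: decs_def)
    have "set p \<subseteq> set as \<and> length p \<le> length as" if "p \<in> set pss" for p
      using that c by (auto simp: length_concat member_le_sum_list)
    with length_decs[OF pss] show "pss \<in> {pss. set pss \<subseteq> ?P \<and> length pss \<le> length as}"
      by blast
  qed
  show "finite {pss. set pss \<subseteq> ?P \<and> length pss \<le> length as}"
    by (simp add: finite_lists_length_le)
qed

section \<open>Splittings of a list into three and their index form\<close>

lemma splits_eq_image: "splits as =
    (\<lambda>(i, j). (take i as, take (j - i) (drop i as), drop j as)) `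
      Sigma {..<length as} (\<lambda>i. {i<..length as})" (is "_ = ?f ` ?I")
proof (intro set_eqI iffI)
  fix t assume "t \<in> splits as"
  then obtain us ws zs where t: "t = (us, ws, zs)" "ws \<noteq> []" "as = us @ ws @ zs"
    by (auto simp: splits_def)
  then have "t = ?f (length us, length us + length ws)" "(length us, length us + length ws) \<in> ?I"
    by auto
  then show "t \<in> ?f ` ?I" by blast
next
  fix t assume "t \<in> ?f ` ?I"
  then obtain i j where "i < j" "j \<le> length as" "t = (take i as, take (j - i) (drop i as), drop j as)"
    by auto
  moreover then have "take (j - i) (drop i as) @ drop j as = drop i as"
    by (metis append_take_drop_id drop_drop le_add_diff_inverse2 less_imp_le)
  ultimately show "t \<in> splits as" by (auto simp: splits_def)
qed

lemma finite_splits [simp]: "finite (splits as)"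
  by (simp add: splits_eq_image)

text \<open>A split is determined by the lengths of its outer parts, so it corresponds to one index
  pair of the double sum in \<open>gerst\<close>.\<close>

lemma sum_splits: "(\<Sum>t\<in>splits as. G t) =
    (\<Sum>i<length as. \<Sum>j\<in>{i<..length as}. G (take i as, take (j - i) (drop i as), drop j as))"
proof -
  have "inj_on (\<lambda>(i, j). (take i as, take (j - i) (drop i as), drop j as))
      (Sigma {..<length as} (\<lambda>i. {i<..length as}))"
  proof (rule inj_onI, clarify)
    fix i j i' j'
    assume a: "i < length as" "i' < length as" "j \<in> {i<..length as}" "j' \<in> {i'<..length as}"
      and t: "take i as = take i' as" "drop j as = drop j' as"
    show "i = i' \<and> j = j'"
      using arg_cong[OF t(1), of length] arg_cong[OF t(2), of length] a by auto
  qed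
  then show ?thesis
    unfolding splits_eq_image by (subst sum.reindex) (simp_all add: sum.Sigma case_prod_beta)
qed

text \<open>\<open>f\<close> may identify entries: a split of a fixed list is already determined by
  the lengths of its parts, which \<open>map\<close> preserves.\<close>

lemma sum_splits_map:
  "(\<Sum>t\<in>splits (map f ls). G t) = (\<Sum>(us, ws, zs)\<in>splits ls. G (map f us, map f ws, map f zs))"
proof (rule sum.reindex_cong)
  let ?f = "\<lambda>(us, ws, zs). (map f us, map f ws, map f zs)"
  show "inj_on ?f (splits ls)"
    by (rule inj_onI) (auto simp: splits_def append_eq_append_conv dest!: map_eq_imp_length_eq)
  show "splits (map f ls) = ?f ` splits ls"
  proof (intro set_eqI iffI)
    fix t assume "t \<in> splits (map f ls)"
    then obtain us ws zs where "t = (us, ws, zs)" "ws \<noteq> []" "map f ls = us @ ws @ zs"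
      by (auto simp: splits_def)
    then obtain us' vs where "ls = us' @ vs" "us = map f us'" "ws @ zs = map f vs"
      by (auto simp: map_eq_append_conv)
    moreover from this(3) obtain ws' zs' where "vs = ws' @ zs'" "ws = map f ws'" "zs = map f zs'"
      by (auto simp: append_eq_map_conv)
    ultimately have "(us', ws', zs') \<in> splits ls" "t = ?f (us', ws', zs')"
      using \<open>t = _\<close> \<open>ws \<noteq> []\<close> by (auto simp: splits_def)
    then show "t \<in> ?f ` splits ls" by blast
  qed (auto simp: splits_def)
qed auto

lemma decs_map: "decs (map f ls) = map (map f) ` decs ls"
proof (intro set_eqI iffI)
  have *: "\<exists>R. concat R = ls \<and> Q = map (map f) R" if "concat Q = map f ls" for Q
    using that
  proof (induction Q arbitrary: ls)
    case (Cons q Q)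
    then have "map f ls = q @ concat Q" by simp
    then obtain us zs where "ls = us @ zs" "q = map f us" "concat Q = map f zs"
      unfolding map_eq_append_conv by metis
    moreover from Cons.IH[OF this(3)] obtain R where "concat R = zs" "Q = map (map f) R" by blast
    ultimately have "concat (us # R) = ls \<and> q # Q = map (map f) (us # R)" by simp
    then show ?case by (rule exI)
  qed simp
  show "Q \<in> map (map f) ` decs ls" if "Q \<in> decs (map f ls)" for Q
  proof -
    from that obtain R where "concat R = ls" "Q = map (map f) R"
      using *[of Q] unfolding decs_def by blast
    moreover from this that have "R \<in> decs ls" by (auto simp: decs_def)
    ultimately show ?thesis by blast
  qed
qed (auto simp: decs_def map_concat)

text \<open>Again \<open>f\<close> may identify entries, because a decomposition of a fixed list is
  determined by its block lengths.\<close>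

lemma sum_decs_map: "(\<Sum>Q\<in>decs (map f ls). G Q) = (\<Sum>R\<in>decs ls. G (map (map f) R))"
proof -
  have "inj_on (map (map f)) (decs ls)"
  proof (rule inj_onI)
    fix R R' assume R: "R \<in> decs ls" "R' \<in> decs ls" and e: "map (map f) R = map (map f) R'"
    have "map (length \<circ> map f) R = map (length \<circ> map f) R'"
      using arg_cong[OF e, of "map length"] by simp
    then have "map length R = map length R'" by (simp add: comp_def)
    then have "length R = length R'" "\<forall>(x, y)\<in>set (zip R R'). length x = length y"
      by (auto simp: set_zip dest: map_eq_imp_length_eq) (metis nth_map)
    then show "R = R'" using R by (intro concat_injective) (auto simp: decs_def)
  qed
  then show ?thesis by (simp add: decs_map sum.reindex)
qed

text \<open>
  \<open>decs_around us zs\<close> are the decompositions of \<open>us @ x # zs\<close>, presented through the piece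
  containing the entry \<open>x\<close>.
\<close>

definition decs_around ::
  "'x list \<Rightarrow> 'x list \<Rightarrow> ('x list list \<times> 'x list \<times> 'x list \<times> 'x list list) set" where
  "decs_around us zs = {(P, u, z, Z). [] \<notin> set P \<and> [] \<notin> set Z \<and> concat P @ u = us \<and> z @ concat Z = zs}"

text \<open>If \<open>P\<close> were shorter than \<open>P'\<close>, the whole marked block of the
  first decomposition would lie in \<open>P'\<close>, making \<open>concat P'\<close> longer than
  \<open>concat P @ u\<close>, which it cannot be.\<close>

lemma concat_pieces_inj:
  assumes "P @ (u @ x # z) # Z = P' @ (u' @ x # z') # Z'"
    "concat P @ u = concat P' @ u'" "z @ concat Z = z' @ concat Z'"
  shows "P = P' \<and> u = u' \<and> z = z' \<and> Z = Z'"
proof -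
  have False if "length P < length P'"
    "P @ (u @ x # z) # Z = P' @ (u' @ x # z') # Z'" "concat P @ u = concat P' @ u'"
    for P P' Z Z' :: "'a list list" and u u' z z'
  proof -
    have t: "take (Suc (length P)) P' = P @ [u @ x # z]"
      using arg_cong[OF that(2), of "take (Suc (length P))"] that(1) by simp
    have "length (concat P') \<ge> length (concat (take (Suc (length P)) P'))"
      by (metis append_take_drop_id concat_append le_add1 length_append)
    then have "length (concat P') > length (concat P @ u)" using t by simp
    then show False using that(3) by simp
  qed
  from this[of P P' u z Z u' z' Z'] this[of P' P u' z' Z' u z Z] assms
  have "length P = length P'" by (metis nat_neq_iff)
  with assms show ?thesis by auto
qed

lemma decs_middle: "decs (us @ x # zs) = (\<lambda>(P, u, z, Z). P @ (u @ x # z) # Z) ` decs_around us zs"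
proof (intro set_eqI iffI)
  fix pss assume a: "pss \<in> decs (us @ x # zs)"
  \<comment> \<open>Cutting right after \<open>x\<close> leaves two cases: the cut runs inside or at
    the start of a block.\<close>
  then have "concat pss = (us @ [x]) @ zs" "pss \<noteq> []" by (auto simp: decs_def)
  from concat_eq_appendD[OF this] obtain P' p z' Z' where 1:
    "pss = P' @ (p @ z') # Z'" "us @ [x] = concat P' @ p" "zs = z' @ concat Z'" by blast
  show "pss \<in> (\<lambda>(P, u, z, Z). P @ (u @ x # z) # Z) ` decs_around us zs"
  proof (cases p rule: rev_cases)
    case (snoc u y)
    with 1 a have "pss = (\<lambda>(P, u, z, Z). P @ (u @ x # z) # Z) (P', u, z', Z')"
      "(P', u, z', Z') \<in> decs_around us zs" by (auto simp: decs_def decs_around_def)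
    then show ?thesis by blast
  next
    case Nil
    \<comment> \<open>The cut falls between two blocks, so \<open>x\<close> ends the last block of
      \<open>P'\<close>.\<close>
    with 1 have c: "concat P' = us @ [x]" by simp
    then obtain P p' where P: "P' = P @ [p']" by (cases P' rule: rev_cases) auto
    then have "p' \<noteq> []" using 1 a by (auto simp: decs_def)
    then obtain u y where "p' = u @ [y]" by (cases p' rule: rev_cases) auto
    with P c 1 a Nil have "pss = (\<lambda>(P, u, z, Z). P @ (u @ x # z) # Z) (P, u, [], z' # Z')"
      "(P, u, [], z' # Z') \<in> decs_around us zs" by (auto simp: decs_def decs_around_def)
    then show ?thesis by blast
  qed
qed (auto simp: decs_def decs_around_def)

lemma inj_decs_middle: "inj_on (\<lambda>(P, u, z, Z). P @ (u @ x # z) # Z) (decs_around us zs)"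
proof (rule inj_onI)
  fix s t
  assume "s \<in> decs_around us zs" "t \<in> decs_around us zs"
    "(\<lambda>(P, u, z, Z). P @ (u @ x # z) # Z) s = (\<lambda>(P, u, z, Z). P @ (u @ x # z) # Z) t"
  then show "s = t"
    by (cases s; cases t) (auto simp: decs_around_def dest!: concat_pieces_inj)
qed

lemma finite_decs_around [simp]: "finite (decs_around us zs)"
  \<comment> \<open>Any marked entry would do; finiteness is pulled back along the
    injection.\<close>
  using finite_decs[of "us @ undefined # zs"] inj_decs_middle
  unfolding decs_middle by (rule finite_imageD)

lemma sum_decs_middle: "(\<Sum>pss\<in>decs (us @ x # zs). G pss) =
    (\<Sum>(P, u, z, Z)\<in>decs_around us zs. G (P @ (u @ x # z) # Z))"
  unfolding decs_middle by (subst sum.reindex[OF inj_decs_middle]) (simp add: case_prod_beta)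

text \<open>The middle block \<open>Q\<close> carries no inner structure. Frames are the common
  outer index of the two sides of the identity for inserted operations.\<close>

definition frames :: "'x list \<Rightarrow> ('x list list \<times> 'x list \<times> 'x list list) set" where
  "frames as = {(P, Q, Z). [] \<notin> set P \<and> [] \<notin> set Z \<and> Q \<noteq> [] \<and> concat P @ Q @ concat Z = as}"

lemma finite_frames [simp]: "finite (frames as)"
proof (rule finite_subset)
  show "frames as \<subseteq> (\<lambda>(pss, P, W, Z). (P, concat W, Z)) ` Sigma (decs as) splits"
  proof clarify
    fix P Q Z assume "(P, Q, Z) \<in> frames as"
    then have "(P @ [Q] @ Z, P, [Q], Z) \<in> Sigma (decs as) splits"
      by (auto simp: frames_def decs_def splits_def)
    then show "(P, Q, Z) \<in> (\<lambda>(pss, P, W, Z). (P, concat W, Z)) ` Sigma (decs as) splits"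
      by force
  qed
qed simp

text \<open>Selecting consecutive blocks \<open>W\<close> of a decomposition amounts to selecting
  their concatenation \<open>Q\<close> and a decomposition of \<open>Q\<close>.\<close>

lemma sum_decs_splits:
  "(\<Sum>pss\<in>decs as. \<Sum>(P, W, Z)\<in>splits pss. G P W Z) = (\<Sum>(P, Q, Z)\<in>frames as. \<Sum>W\<in>decs Q. G P W Z)"
proof -
  have "(\<Sum>(pss, P, W, Z)\<in>Sigma (decs as) splits. G P W Z) =
      (\<Sum>((P, Q, Z), W)\<in>Sigma (frames as) (\<lambda>(P, Q, Z). decs Q). G P W Z)"
    by (rule sum.reindex_bij_witness[where
          i = "\<lambda>((P, Q, Z), W). (P @ W @ Z, P, W, Z)" and j = "\<lambda>(pss, P, W, Z). ((P, concat W, Z), W)"])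
       (auto simp: decs_def splits_def frames_def neq_Nil_concat)
  then show ?thesis by (simp add: sum.Sigma case_prod_unfold)
qed

text \<open>The block holding an inserted value turns into \<open>Q\<close> when that value is
  replaced by the inputs \<open>ws\<close> it was computed from.\<close>

lemma sum_splits_around:
  "(\<Sum>(us, ws, zs)\<in>splits as. \<Sum>(P, u, z, Z)\<in>decs_around us zs. G P u ws z Z) =
   (\<Sum>(P, Q, Z)\<in>frames as. \<Sum>(u, ws, z)\<in>splits Q. G P u ws z Z)"
proof -
  have "(\<Sum>((us, ws, zs), P, u, z, Z)\<in>Sigma (splits as) (\<lambda>(us, ws, zs). decs_around us zs). G P u ws z Z) =
      (\<Sum>((P, Q, Z), u, ws, z)\<in>Sigma (frames as) (\<lambda>(P, Q, Z). splits Q). G P u ws z Z)"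
    by (rule sum.reindex_bij_witness[where
          i = "\<lambda>((P, Q, Z), u, ws, z). ((concat P @ u, ws, z @ concat Z), P, u, z, Z)" and
          j = "\<lambda>((us, ws, zs), P, u, z, Z). ((P, u @ ws @ z, Z), u, ws, z)"])
       (auto simp: decs_around_def splits_def frames_def)
  then show ?thesis by (simp add: sum.Sigma case_prod_unfold)
qed

lemma finite_listset: "(\<And>A. A \<in> set As \<Longrightarrow> finite A) \<Longrightarrow> finite (listset As)"
proof (induction As)
  case (Cons A As)
  then show ?case
    using finite_image_set2[of "\<lambda>x. x \<in> A" "\<lambda>xs. xs \<in> listset As" "(#)"] by (simp add: set_Cons_def)
qed simp

lemma concat_concat: "concat (concat R) = concat (map concat R)"
  by (induction R) auto

text \<open>Grouping the blocks of a fine decomposition is the same as refining every block of a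
  coarse one; \<open>r\<close> counts the coarse blocks.\<close>

lemma sum_decs_decs:
  "(\<Sum>pss\<in>decs as. \<Sum>R\<in>{R\<in>decs pss. length R = r}. G R) =
   (\<Sum>P\<in>{P\<in>decs as. length P = r}. \<Sum>R\<in>listset (map decs P). G R)"
proof -
  have ls: "R \<in> listset (map decs P) \<longleftrightarrow> P = map concat R \<and> (\<forall>q\<in>set R. [] \<notin> set q)"
    for R :: "'b list list list" and P
    by (induction P arbitrary: R) (auto simp: set_Cons_def decs_def)
  have ne: "[] \<in> set R" if "[] \<in> concat ` set R" "\<forall>q\<in>set R. [] \<notin> set q" for R :: "'b list list list"
    using that neq_Nil_concat by (metis concat_eq_Nil_conv imageE)
  \<comment> \<open>The two-level decompositions. Both index sets are graphs over \<open>?X\<close>,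
    of \<open>concat\<close> and of \<open>map concat\<close>.\<close>
  let ?X = "{R. (\<forall>q\<in>set R. [] \<notin> set q) \<and> [] \<notin> set R \<and> concat (concat R) = as \<and> length R = r}"
  have 1: "Sigma (decs as) (\<lambda>pss. {R\<in>decs pss. length R = r}) = (\<lambda>R. (concat R, R)) ` ?X"
    by (auto simp: decs_def)
  have "(P, R) \<in> Sigma {P\<in>decs as. length P = r} (\<lambda>P. listset (map decs P)) \<longleftrightarrow>
      P = map concat R \<and> R \<in> ?X" for P R
    using ne[of R] image_eqI[of "[]" concat "[]" "set R"]
    unfolding mem_Sigma_iff ls by (auto simp: decs_def concat_concat)
  then have 2: "Sigma {P\<in>decs as. length P = r} (\<lambda>P. listset (map decs P)) =
      (\<lambda>R. (map concat R, R)) ` ?X" by (intro set_eqI) force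
  have "(\<Sum>(pss, R)\<in>Sigma (decs as) (\<lambda>pss. {R\<in>decs pss. length R = r}). G R) =
      (\<Sum>(P, R)\<in>Sigma {P\<in>decs as. length P = r} (\<lambda>P. listset (map decs P)). G R)"
    unfolding 1 2 by (simp add: sum.reindex inj_on_def)
  moreover have "finite (listset (map decs P))" for P :: "'b list list"
    by (rule finite_listset) auto
  ultimately show ?thesis by (simp add: sum.Sigma)
qed

section \<open>The operations on paths\<close>

lemma nth_seg: "k < j - i \<Longrightarrow> j \<le> length xs \<Longrightarrow> seg i j xs ! k = xs ! (i + k)"
  by (simp add: seg_def)

lemma length_seg: "j \<le> length xs \<Longrightarrow> length (seg i j xs) = j - i"
  by (simp add: seg_def)

lemma seg_arr:
  assumes "length xs = Suc (length vs)" "i < j" "j \<le> length vs"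
  shows "seg i j (arr xs vs) = arr (seg i (Suc j) xs) (seg i j vs)"
  by (rule nth_equalityI) (use assms in \<open>simp_all add: length_seg length_arr nth_seg nth_arr\<close>)

text \<open>The objects of a block include both ends, hence \<open>Suc j\<close> on the object
  side.\<close>

lemma app_seg_arr:
  assumes "length xs = Suc (length vs)" "i < j" "j \<le> length vs"
  shows "app f (seg i j (arr xs vs)) = f (seg i (Suc j) xs) (seg i j vs)"
    "pdeg (seg i j (arr xs vs)) = deg (seg i j vs)"
    "src (hd (seg i j (arr xs vs))) = xs ! i" "tgt (last (seg i j (arr xs vs))) = xs ! j"
proof -
  have l: "length (seg i (Suc j) xs) = Suc (length (seg i j vs))"
    using assms by (simp add: length_seg)
  have ne: "seg i j vs \<noteq> []" "seg i j (arr xs vs) \<noteq> []"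
    using assms length_seg[of j vs i] length_seg[of j "arr xs vs" i] by (auto simp: length_arr)
  show "app f (seg i j (arr xs vs)) = f (seg i (Suc j) xs) (seg i j vs)"
    "pdeg (seg i j (arr xs vs)) = deg (seg i j vs)"
    using assms l ne by (simp_all add: seg_arr app_arr pdeg_arr)
  show "src (hd (seg i j (arr xs vs))) = xs ! i" "tgt (last (seg i j (arr xs vs))) = xs ! j"
    using assms ne by (simp_all add: hd_conv_nth last_conv_nth length_seg length_arr nth_seg nth_arr)
qed

lemma gerst_outside: "vs \<notin> tensors A xs \<Longrightarrow> gerst A f em xs vs = 0"
  and brace_outside: "vs \<notin> tensors A xs \<Longrightarrow> brace A \<Psi> k hs xs vs = 0"
  and comp_outside: "vs \<notin> tensors A xs \<Longrightarrow> comp_cochain A \<Psi> k h xs vs = 0"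
  by (simp_all add: gerst_def brace_def comp_cochain_def)

lemma app_gerst:
  assumes "path A as"
  shows "app (gerst A f (e, m)) as =
    (\<Sum>(us, ws, zs)\<in>splits as. signed (e * pdeg us) (app f (us @ hat id (e, m) ws # zs)))"
proof -
  obtain xs vs where vs: "vs \<in> tensors A xs" and as: "as = arr xs vs"
    and l: "length xs = Suc (length vs)" and ne: "vs \<noteq> []"
    using assms by (rule path_tensors)
  have term_eq: "signed (e * deg (take i vs))
          (f (take (Suc i) xs @ drop j xs)
             (take i vs @ [(e + deg (seg i j vs), m (seg i (Suc j) xs) (seg i j vs))] @ drop j vs)) =
        signed (e * pdeg (take i as)) (app f (take i as @ hat id (e, m) (seg i j as) # drop j as))"
    if ij: "i \<in> {..<length vs}" "j \<in> {i<..length vs}" for i j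
  proof -
    let ?bs = "take i as @ hat id (e, m) (seg i j as) # drop j as"
    have ij': "i < j" "j \<le> length vs" using ij by auto
    have take: "map elt (take i as) = take i vs" "map elt (drop j as) = drop j vs"
      using l by (simp_all add: as elt_arr flip: take_map drop_map)
    have "map elt ?bs =
        take i vs @ [(e + deg (seg i j vs), m (seg i (Suc j) xs) (seg i j vs))] @ drop j vs"
      using take ij' l by (simp add: elt_hat app_seg_arr as)
    \<comment> \<open>The inserted arrow runs from object i to object j, so exactly the objects
      strictly between them disappear.\<close>
    moreover have "map src ?bs @ [tgt (last ?bs)] = take (Suc i) xs @ drop j xs"
    proof (rule nth_equalityI)
      show len: "length (map src ?bs @ [tgt (last ?bs)]) = length (take (Suc i) xs @ drop j xs)"
        using ij' l by (simp add: as length_arr)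
      fix n assume "n < length (map src ?bs @ [tgt (last ?bs)])"
      then have "n \<le> Suc i + (length vs - j)" using ij' l by (simp add: as length_arr)
      then consider "n < i" | "n = i" | "i < n" "n < Suc i + (length vs - j)"
        | "n = Suc i + (length vs - j)" by linarith
      then show "(map src ?bs @ [tgt (last ?bs)]) ! n = (take (Suc i) xs @ drop j xs) ! n"
      proof cases
        case 3
        define n' where "n' = n - Suc i"
        with 3 have "n = Suc i + n'" "j + n' < length vs" "n' < length vs - j" by auto
        then show ?thesis using ij' l by (simp add: nth_append as length_arr nth_arr)
      next
        case 4
        show ?thesis
        \<comment> \<open>If nothing follows the inserted arrow, the final target is its
          own.\<close>
        proof (cases "j = length vs")
          case True
          then show ?thesis using 4 ij' l by (simp add: nth_append as length_arr app_seg_arr)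
        next
          case False
          then have "last ?bs = as ! (length vs - 1)"
            using ij' l length_arr[OF l] by (cases "as = []") (simp_all add: as last_conv_nth[of "arr xs vs"])
          then have "tgt (last ?bs) = xs ! length vs"
            using ij' l ne by (simp add: as nth_arr)
          moreover have "(map src ?bs @ [tgt (last ?bs)]) ! n = tgt (last ?bs)"
            using 4 ij' l nth_append_length[of "map src ?bs" "tgt (last ?bs)" "[]"]
            by (simp add: as length_arr)
          moreover have "(take (Suc i) xs @ drop j xs) ! n = xs ! length vs"
            using 4 ij' l by (auto simp: nth_append)
          ultimately show ?thesis by (simp only:)
        qed
      qed (use ij' l in \<open>simp_all add: nth_append as length_arr nth_arr app_seg_arr\<close>)
    qed
    ultimately show ?thesis using take by (simp add: app_def pdeg_def)
  qed
  have "gerst A f (e, m) xs vs = (\<Sum>i<length vs. \<Sum>j\<in>{i<..length vs}.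
      signed (e * pdeg (take i as)) (app f (take i as @ hat id (e, m) (seg i j as) # drop j as)))"
    unfolding gerst_def if_P[OF vs] fst_conv snd_conv by (intro sum.cong refl term_eq)
  then show ?thesis
    using l by (simp add: as app_arr ne sum_splits length_arr flip: seg_def)
qed

section \<open>Cut points and decompositions into blocks\<close>

lemma cuts_D:
  assumes "ps \<in> cuts n r"
  shows "length ps = Suc r" "ps ! 0 = 0" "ps ! r = n" "j < r \<Longrightarrow> ps ! j < ps ! Suc j"
    "j \<le> r \<Longrightarrow> ps ! j \<le> n"
proof -
  have ps: "length ps = Suc r" "sorted_wrt (<) ps" "hd ps = 0" "last ps = n"
    using assms by (auto simp: cuts_def)
  then have "ps \<noteq> []" by auto
  with ps show "length ps = Suc r" "ps ! 0 = 0" and n: "ps ! r = n"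
    by (auto simp: hd_conv_nth last_conv_nth)
  show "j < r \<Longrightarrow> ps ! j < ps ! Suc j" using ps by (simp add: sorted_wrt_nth_less)
  show "ps ! j \<le> n" if "j \<le> r"
    using that ps n sorted_wrt_nth_less[OF ps(2), of j r] by (cases "j = r") auto
qed

definition pieces :: "'x list \<Rightarrow> nat list \<Rightarrow> 'x list list" where
  "pieces as ps = map (\<lambda>j. seg (ps ! j) (ps ! Suc j) as) [0..<length ps - 1]"

definition cut_points :: "'x list list \<Rightarrow> nat list" where
  "cut_points pss = map (\<lambda>j. length (concat (take j pss))) [0..<Suc (length pss)]"

text \<open>Both the inversion of \<open>pieces\<close> and the signs of \<open>brace\<close> rest
  on this: the inputs that an operation moves past are those of the earlier pieces.\<close>

lemma concat_take_pieces:
  assumes "ps \<in> cuts (length as) r" "j \<le> r"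
  shows "concat (take j (pieces as ps)) = take (ps ! j) as"
  using assms(2)
proof (induction j)
  case 0
  then show ?case using cuts_D(2)[OF assms(1)] by simp
next
  case (Suc j)
  have j: "j < length (pieces as ps)" using Suc.prems cuts_D(1)[OF assms(1)] by (simp add: pieces_def)
  have "ps ! j < ps ! Suc j" using cuts_D(4)[OF assms(1)] Suc.prems by simp
  then have "take (ps ! j) as @ seg (ps ! j) (ps ! Suc j) as = take (ps ! Suc j) as"
    by (simp add: seg_def flip: take_add)
  moreover have "pieces as ps ! j = seg (ps ! j) (ps ! Suc j) as"
    using j by (simp add: pieces_def)
  ultimately show ?case using Suc j by (simp add: take_Suc_conv_app_nth)
qed

lemma pieces_decs:
  assumes "ps \<in> cuts (length as) r"
  shows "pieces as ps \<in> decs as" "length (pieces as ps) = r"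
proof -
  show l: "length (pieces as ps) = r" using cuts_D[OF assms] by (simp add: pieces_def)
  have "concat (pieces as ps) = as"
    using concat_take_pieces[OF assms order_refl] cuts_D[OF assms] l by simp
  moreover have "[] \<notin> set (pieces as ps)"
  proof
    assume "[] \<in> set (pieces as ps)"
    then obtain j where "j < r" "seg (ps ! j) (ps ! Suc j) as = []"
      using cuts_D(1)[OF assms] by (auto simp: pieces_def)
    with cuts_D(4,5)[OF assms, of j] cuts_D(5)[OF assms, of "Suc j"]
      length_seg[of "ps ! Suc j" as "ps ! j"] show False by simp
  qed
  ultimately show "pieces as ps \<in> decs as" by (simp add: decs_def)
qed

lemma nth_cut_points: "j \<le> length pss \<Longrightarrow> cut_points pss ! j = length (concat (take j pss))"
  unfolding cut_points_def by (subst nth_map) (simp_all del: upt_Suc)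

lemma cut_points_cuts:
  assumes "pss \<in> decs as"
  shows "cut_points pss \<in> cuts (length as) (length pss)"
proof -
  have l: "length (cut_points pss) = Suc (length pss)" by (simp add: cut_points_def)
  have "sorted_wrt (<) (cut_points pss)"
    unfolding sorted_wrt_iff_nth_Suc_transp[OF transp_on_less]
  proof (intro allI impI)
    fix j assume "Suc j < length (cut_points pss)"
    then have j: "j < length pss" using l by simp
    then have "pss ! j \<noteq> []" using assms nth_mem by (fastforce simp: decs_def)
    then show "cut_points pss ! j < cut_points pss ! Suc j"
      using j by (simp add: nth_cut_points take_Suc_conv_app_nth)
  qed
  moreover have "cut_points pss \<noteq> []" using l by auto
  ultimately show ?thesis
    using l assms by (auto simp: cuts_def hd_conv_nth last_conv_nth nth_cut_points decs_def)
qed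

lemma cut_points_pieces: "ps \<in> cuts (length as) r \<Longrightarrow> cut_points (pieces as ps) = ps"
  using concat_take_pieces[of ps as r] cuts_D[of ps "length as" r] pieces_decs[of ps as r]
  by (intro nth_equalityI) (simp_all add: cut_points_def nth_cut_points del: upt_Suc)

lemma pieces_cut_points:
  assumes "pss \<in> decs as"
  shows "pieces as (cut_points pss) = pss"
proof (rule nth_equalityI)
  show l: "length (pieces as (cut_points pss)) = length pss"
    by (simp add: pieces_def cut_points_def)
  fix j assume "j < length (pieces as (cut_points pss))"
  then have j: "j < length pss" using l by simp
  have "as = concat (take j pss) @ pss ! j @ concat (drop (Suc j) pss)"
    using assms j by (auto simp: decs_def) (metis concat.simps(2) concat_append id_take_nth_drop)
  then show "pieces as (cut_points pss) ! j = pss ! j"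
    using j l
    by (simp add: pieces_def nth_cut_points seg_def take_Suc_conv_app_nth)
qed

lemma sum_cuts: "(\<Sum>ps\<in>cuts (length as) r. G (pieces as ps)) = (\<Sum>pss\<in>{pss\<in>decs as. length pss = r}. G pss)"
  by (rule sum.reindex_bij_witness[where i = cut_points and j = "pieces as"])
     (auto simp: cut_points_pieces pieces_cut_points pieces_decs cut_points_cuts)

text \<open>The Koszul exponent of \<open>brace\<close>, read off from blocks instead of cut
  points.\<close>

definition brace_deg :: "(int \<times> 'f) list \<Rightarrow> ('o, 'v) arrow list list \<Rightarrow> int" where
  "brace_deg hs pss = (\<Sum>j<length hs. fst (hs ! j) * pdeg (concat (take j pss)))"

lemma app_brace:
  assumes "path C as"
  shows "app (brace C \<Psi> k hs) as = (\<Sum>pss\<in>{pss\<in>decs as. length pss = length hs}.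
    signed (brace_deg hs pss) (app k (map2 (hat \<Psi>) hs pss)))"
proof -
  obtain xs vs where vs: "vs \<in> tensors C xs" and as: "as = arr xs vs"
    and l: "length xs = Suc (length vs)" and ne: "vs \<noteq> []"
    using assms by (rule path_tensors)
  let ?r = "length hs"
  have len: "length as = length vs" by (simp add: as l length_arr)
  have "signed (\<Sum>j<?r. fst (hs ! j) * deg (take (ps ! j) vs))
          (k (map (\<lambda>p. \<Psi> (xs ! p)) ps)
             (map (\<lambda>j. let ys = seg (ps ! j) (Suc (ps ! Suc j)) xs;
                           ws = seg (ps ! j) (ps ! Suc j) vs
                       in (fst (hs ! j) + deg ws, snd (hs ! j) ys ws)) [0..<?r])) =
        signed (brace_deg hs (pieces as ps)) (app k (map2 (hat \<Psi>) hs (pieces as ps)))"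
    if ps: "ps \<in> cuts (length as) ?r" for ps
  proof -
    note D = cuts_D[OF ps]
    \<comment> \<open>A nonempty tensor cannot be cut into zero pieces; a last piece is needed for
      the final target.\<close>
    have r: "?r > 0" using D(2,3) ne len by (cases ?r) auto
    let ?bs = "map2 (hat \<Psi>) hs (pieces as ps)"
    have lb: "length ?bs = ?r" "length (pieces as ps) = ?r" using pieces_decs[OF ps] by simp_all
    have nth: "?bs ! j = hat \<Psi> (hs ! j) (seg (ps ! j) (ps ! Suc j) as)" if "j < ?r" for j
      using that lb D(1) by (simp add: pieces_def)
    have pj: "ps ! j < ps ! Suc j \<and> ps ! Suc j \<le> length vs" if "j < ?r" for j
      using D(4)[of j] D(5)[of "Suc j"] that len by simp
    have "brace_deg hs (pieces as ps) = (\<Sum>j<?r. fst (hs ! j) * deg (take (ps ! j) vs))"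
      unfolding brace_deg_def
    proof (rule sum.cong)
      fix j assume "j \<in> {..<?r}"
      then have "concat (take j (pieces as ps)) = take (ps ! j) as"
        using concat_take_pieces[OF ps] by simp
      then show "fst (hs ! j) * pdeg (concat (take j (pieces as ps))) = fst (hs ! j) * deg (take (ps ! j) vs)"
        by (simp add: pdeg_def as elt_arr l flip: take_map)
    qed simp
    moreover have "map src ?bs @ [tgt (last ?bs)] = map (\<lambda>p. \<Psi> (xs ! p)) ps"
    proof (rule nth_equalityI)
      have "?bs \<noteq> []" using lb r by auto
      fix j assume "j < length (map src ?bs @ [tgt (last ?bs)])"
      then consider "j < ?r" | "j = ?r" using lb by fastforce
      then show "(map src ?bs @ [tgt (last ?bs)]) ! j = map (\<lambda>p. \<Psi> (xs ! p)) ps ! j"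
      proof cases
        case 1
        then have "(map src ?bs @ [tgt (last ?bs)]) ! j = src (?bs ! j)"
          using lb by (simp add: nth_append)
        then show ?thesis using 1 D(1) pj[OF 1] l by (simp only: nth) (simp add: as app_seg_arr)
      next
        case 2
        have "last ?bs = ?bs ! (?r - 1)" using last_conv_nth[OF \<open>?bs \<noteq> []\<close>] unfolding lb .
        then have "(map src ?bs @ [tgt (last ?bs)]) ! j = tgt (?bs ! (?r - 1))"
          using lb 2 by (simp add: nth_append)
        then show ?thesis using 2 r D(1) pj[of "?r - 1"] l nth[of "?r - 1"] by (simp add: as app_seg_arr)
      qed
    qed (use lb D in simp)
    moreover have "map elt ?bs = map (\<lambda>j. let ys = seg (ps ! j) (Suc (ps ! Suc j)) xs;
                           ws = seg (ps ! j) (ps ! Suc j) vs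
                       in (fst (hs ! j) + deg ws, snd (hs ! j) ys ws)) [0..<?r]"
    proof (rule nth_equalityI)
      fix j assume "j < length (map elt ?bs)"
      then have j: "j < ?r" using lb by simp
      then have "map elt ?bs ! j = elt (?bs ! j)" using lb by simp
      then show "map elt ?bs ! j = map (\<lambda>j. let ys = seg (ps ! j) (Suc (ps ! Suc j)) xs;
                           ws = seg (ps ! j) (ps ! Suc j) vs
                       in (fst (hs ! j) + deg ws, snd (hs ! j) ys ws)) [0..<?r] ! j"
        using j pj[OF j] l by (simp only: nth) (simp add: elt_hat as app_seg_arr Let_def)
    qed (use lb in simp)
    ultimately show ?thesis by (simp add: app_def)
  qed
  then have "brace C \<Psi> k hs xs vs = (\<Sum>ps\<in>cuts (length as) ?r.
      signed (brace_deg hs (pieces as ps)) (app k (map2 (hat \<Psi>) hs (pieces as ps))))"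
    using vs by (simp add: brace_def len cong: sum.cong)
  then show ?thesis
    unfolding sum_cuts[where G = "\<lambda>pss. signed (brace_deg hs pss) (app k (map2 (hat \<Psi>) hs pss))"]
    by (simp add: as app_arr l ne)
qed

text \<open>All signs vanish in degree 0, and the sum over r merely sorts decompositions by their
  number of blocks, which lies between 1 and the number of inputs.\<close>

lemma app_comp:
  assumes "path C as"
  shows "app (comp_cochain C \<Psi> k (0, h)) as = (\<Sum>pss\<in>decs as. app k (map (hat \<Psi> (0, h)) pss))"
proof -
  have ne: "as \<noteq> []" using assms by (simp add: path_def)
  have "app (brace C \<Psi> k (replicate r (0, h))) as =
      (\<Sum>pss\<in>{pss\<in>decs as. length pss = r}. app k (map (hat \<Psi> (0, h)) pss))" for r
    unfolding app_brace[OF assms]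
    by (rule sum.cong) (auto simp: brace_deg_def zip_replicate1 comp_def)
  then have "app (comp_cochain C \<Psi> k (0, h)) as =
      (\<Sum>r=1..length as. \<Sum>pss\<in>{pss\<in>decs as. length pss = r}. app k (map (hat \<Psi> (0, h)) pss))"
    by (simp add: app_def comp_cochain_def)
  also have "\<dots> = (\<Sum>pss\<in>decs as. app k (map (hat \<Psi> (0, h)) pss))"
  proof (rule sum.group)
    show "length ` decs as \<subseteq> {1..length as}"
      using ne length_decs by (force simp: decs_def Suc_le_eq)
  qed simp_all
  finally show ?thesis .
qed

section \<open>Multilinearity on paths\<close>

lemma
  assumes "graded_quiver A" "x \<in> objs A" "y \<in> objs A"
  shows hom_zero: "0 \<in> hom A x y i"
    and hom_signed: "v \<in> hom A x y i \<Longrightarrow> signed s v \<in> hom A x y i"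
    and hom_add: "v \<in> hom A x y i \<Longrightarrow> w \<in> hom A x y i \<Longrightarrow> v + w \<in> hom A x y i"
    and hom_scl: "v \<in> hom A x y i \<Longrightarrow> scl A c v \<in> hom A x y i"
    and hom_sum: "(\<And>q. q \<in> D \<Longrightarrow> u q \<in> hom A x y i) \<Longrightarrow> sum u D \<in> hom A x y i"
proof -
  interpret vector_space "scl A" using assms by (simp add: graded_quiver_def)
  have "subspace (hom A x y i)" using assms by (simp add: graded_quiver_def)
  then show "0 \<in> hom A x y i" "v \<in> hom A x y i \<Longrightarrow> signed s v \<in> hom A x y i"
    "v \<in> hom A x y i \<Longrightarrow> w \<in> hom A x y i \<Longrightarrow> v + w \<in> hom A x y i"
    "v \<in> hom A x y i \<Longrightarrow> scl A c v \<in> hom A x y i"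
    "(\<And>q. q \<in> D \<Longrightarrow> u q \<in> hom A x y i) \<Longrightarrow> sum u D \<in> hom A x y i"
    by (simp_all add: signed_def subspace_0 subspace_neg subspace_add subspace_scale subspace_sum)
qed

lemma
  assumes "graded_quiver A"
  shows scl_sum: "scl A c (sum u D) = (\<Sum>q\<in>D. scl A c (u q))"
    and scl_scl: "scl A c (scl A c' v) = scl A (c * c') v"
    and scl_add: "scl A c (v + w) = scl A c v + scl A c w"
    and scl_zero: "scl A c 0 = 0" "scl A 0 v = 0"
    and scl_minus_one: "scl A (-1) v = - v"
proof -
  interpret vector_space "scl A" using assms by (simp add: graded_quiver_def)
  show "scl A c (sum u D) = (\<Sum>q\<in>D. scl A c (u q))"
    "scl A c (scl A c' v) = scl A (c * c') v" "scl A c (v + w) = scl A c v + scl A c w"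
    "scl A c 0 = 0" "scl A 0 v = 0" "scl A (-1) v = - v"
    by (simp_all add: scale_sum_right scale_right_distrib)
qed

lemma path_elt:
  assumes "path A (us @ (x, (e, v), y) # zs)"
  shows "x \<in> objs A" "y \<in> objs A" "v \<in> hom A x y (1 + e)"
    and "v' \<in> hom A x y (1 + e) \<Longrightarrow> path A (us @ (x, (e, v'), y) # zs)"
proof -
  show *: "x \<in> objs A" "y \<in> objs A" "v \<in> hom A x y (1 + e)"
    using assms by (auto simp: path_def arrows_def)
  assume "v' \<in> hom A x y (1 + e)"
  then show "path A (us @ (x, (e, v'), y) # zs)"
    using path_replace[of A us "[(x, (e, v), y)]" zs "[(x, (e, v'), y)]"] assms *
    by (simp add: path_single arrows_def)
qed

lemma arr_update:
  assumes "length xs = Suc (length vs)" "arr xs vs = us @ (x, (e, v), y) # zs"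
  shows "arr xs (vs[length us := (e, u)]) = us @ (x, (e, u), y) # zs"
    "vs ! length us = (e, v)" "length us < length vs" "xs ! length us = x" "xs ! Suc (length us) = y"
proof -
  show l: "length us < length vs"
    using arg_cong[OF assms(2), of length] assms(1) by (simp add: length_arr)
  have "arr xs vs ! length us = (x, (e, v), y)" using assms(2) by simp
  then show *: "vs ! length us = (e, v)" "xs ! length us = x" "xs ! Suc (length us) = y"
    using l assms(1) by (simp_all add: nth_arr)
  have "arr xs (vs[length us := (e, u)]) = (arr xs vs)[length us := (x, (e, u), y)]"
    by (rule nth_equalityI) (use assms(1) l * in \<open>auto simp: length_arr nth_arr nth_list_update\<close>)
  then show "arr xs (vs[length us := (e, u)]) = us @ (x, (e, u), y) # zs"
    by (simp add: assms(2))
qed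

text \<open>The axioms of \<open>cochains\<close> with the slot displayed inside a path. The degree
  \<open>e\<close> of the slot is fixed, as entries of different degrees are never added.\<close>

lemma
  assumes f: "f \<in> cochains A B \<Phi> d"
  shows cochains_outside: "vs \<notin> tensors A xs \<Longrightarrow> f xs vs = 0"
    and app_hom: "path A as \<Longrightarrow>
      app f as \<in> hom B (\<Phi> (src (hd as))) (\<Phi> (tgt (last as))) (1 + (d + pdeg as))"
    and app_add: "path A (us @ (x, (e, v), y) # zs) \<Longrightarrow> w \<in> hom A x y (1 + e) \<Longrightarrow>
      app f (us @ (x, (e, v + w), y) # zs) =
        app f (us @ (x, (e, v), y) # zs) + app f (us @ (x, (e, w), y) # zs)"
    and app_scl: "path A (us @ (x, (e, v), y) # zs) \<Longrightarrow>
      app f (us @ (x, (e, scl A c v), y) # zs) = scl B c (app f (us @ (x, (e, v), y) # zs))"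
proof -
  show "vs \<notin> tensors A xs \<Longrightarrow> f xs vs = 0" using f by (simp add: cochains_def)
  show "app f as \<in> hom B (\<Phi> (src (hd as))) (\<Phi> (tgt (last as))) (1 + (d + pdeg as))" if "path A as"
  proof -
    from that obtain xs vs where vs: "vs \<in> tensors A xs" and as: "as = arr xs vs"
      and l: "length xs = Suc (length vs)" and ne: "vs \<noteq> []" by (rule path_tensors)
    have "map src as @ [tgt (last as)] = xs" using l ne by (simp add: as objs_arr)
    moreover have "as \<noteq> []" using that by (simp add: path_def)
    ultimately have "src (hd as) = hd xs" "tgt (last as) = last xs"
      by (auto simp: hd_append hd_map)
    then show ?thesis using f vs l ne by (simp add: as cochains_def app_arr pdeg_arr shift_def)
  qed
  {
    assume p: "path A (us @ (x, (e, v), y) # zs)"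
    then obtain xs vs where vs: "vs \<in> tensors A xs" and as: "us @ (x, (e, v), y) # zs = arr xs vs"
      and l: "length xs = Suc (length vs)" and ne: "vs \<noteq> []" by (rule path_tensors)
    note u = arr_update[OF l as[symmetric]]
    have *: "app f (us @ (x, (e, u), y) # zs) = f xs (vs[length us := (e, u)])" for u
      using l ne by (simp add: app_arr flip: u(1))
    have v: "v \<in> shift 1 (hom A x y) e" using path_elt(3)[OF p] by (simp add: shift_def)
    then have 1: "f xs (vs[length us := (e, v + w)]) = f xs (vs[length us := (e, v)]) + f xs (vs[length us := (e, w)])"
      if "w \<in> shift 1 (hom A x y) e" for w
      using f vs u(2-) that unfolding cochains_def by fastforce
    from v have 2: "f xs (vs[length us := (e, scl A c v)]) = scl B c (f xs (vs[length us := (e, v)]))"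
      using f vs u(2-) unfolding cochains_def by fastforce
    show "app f (us @ (x, (e, v + w), y) # zs) =
        app f (us @ (x, (e, v), y) # zs) + app f (us @ (x, (e, w), y) # zs)" if "w \<in> hom A x y (1 + e)"
      using 1[of w] that by (simp add: * shift_def)
    show "app f (us @ (x, (e, scl A c v), y) # zs) = scl B c (app f (us @ (x, (e, v), y) # zs))"
      using 2 by (simp add: *)
  }
qed

lemma cochainsI:
  assumes "\<And>xs vs. vs \<notin> tensors A xs \<Longrightarrow> f xs vs = 0"
    and hom: "\<And>as. path A as \<Longrightarrow>
      app f as \<in> hom B (\<Phi> (src (hd as))) (\<Phi> (tgt (last as))) (1 + (d + pdeg as))"
    and add: "\<And>us x e v y zs w. path A (us @ (x, (e, v), y) # zs) \<Longrightarrow> w \<in> hom A x y (1 + e) \<Longrightarrow>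
      app f (us @ (x, (e, v + w), y) # zs) =
        app f (us @ (x, (e, v), y) # zs) + app f (us @ (x, (e, w), y) # zs)"
    and scl: "\<And>us x e v y zs c. path A (us @ (x, (e, v), y) # zs) \<Longrightarrow>
      app f (us @ (x, (e, scl A c v), y) # zs) = scl B c (app f (us @ (x, (e, v), y) # zs))"
  shows "f \<in> cochains A B \<Phi> d"
  unfolding cochains_def mem_Collect_eq
proof (intro conjI allI ballI impI assms(1))
  fix xs vs assume vs: "vs \<in> tensors A xs"
  then have l: "length xs = Suc (length vs)" and p: "path A (arr xs vs)" by (simp_all add: tensors_iff_path)
  then have ne: "vs \<noteq> []" "arr xs vs \<noteq> []" by (auto simp: path_def arr_def)
  have "map src (arr xs vs) @ [tgt (last (arr xs vs))] = xs" using l ne by (simp add: objs_arr)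
  then have "src (hd (arr xs vs)) = hd xs" "tgt (last (arr xs vs)) = last xs"
    using ne by (metis hd_append hd_map map_is_Nil_conv) (metis last_snoc \<open>_ = xs\<close>)
  then show "f xs vs \<in> shift 1 (hom B (\<Phi> (hd xs)) (\<Phi> (last xs))) (d + deg vs)"
    using hom[OF p] l ne by (simp add: app_arr pdeg_arr shift_def)
  fix i v w c
  assume i: "i < length vs" and v: "v \<in> shift 1 (hom A (xs ! i) (xs ! Suc i)) (fst (vs ! i))"
    and w: "w \<in> shift 1 (hom A (xs ! i) (xs ! Suc i)) (fst (vs ! i))"
  define us zs where "us = take i (arr xs vs)" "zs = drop (Suc i) (arr xs vs)"
  have lu: "length us = i" using i l by (simp add: us_zs_def length_arr)
  have as: "arr xs vs = us @ (xs ! i, (fst (vs ! i), snd (vs ! i)), xs ! Suc i) # zs"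
    using i l id_take_nth_drop[of i "arr xs vs"] by (simp add: us_zs_def length_arr nth_arr)
  have eq: "f xs (vs[i := (fst (vs ! i), u)]) = app f (us @ (xs ! i, (fst (vs ! i), u), xs ! Suc i) # zs)" for u
    using arr_update(1)[OF l as, of u] l ne app_arr[of xs "vs[i := (fst (vs ! i), u)]" f] by (simp add: lu)
  have pv: "path A (us @ (xs ! i, (fst (vs ! i), v), xs ! Suc i) # zs)"
    using path_elt(4)[OF p[unfolded as]] v by (simp add: shift_def)
  show "f xs (vs[i := (fst (vs ! i), v + w)]) =
      f xs (vs[i := (fst (vs ! i), v)]) + f xs (vs[i := (fst (vs ! i), w)])"
    using add[OF pv] w by (simp add: eq shift_def)
  show "f xs (vs[i := (fst (vs ! i), scl A c v)]) = scl B c (f xs (vs[i := (fst (vs ! i), v)]))"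
    using scl[OF pv] by (simp add: eq)
qed

text \<open>Additivity at \<open>0 + 0\<close>. The entry \<open>v\<close> certifies that the
  surroundings form a path.\<close>

lemma app_zero:
  assumes "f \<in> cochains A B \<Phi> d" "graded_quiver A" "path A (us @ (x, (e, v), y) # zs)"
  shows "app f (us @ (x, (e, 0), y) # zs) = 0"
proof -
  have 0: "0 \<in> hom A x y (1 + e)" using assms path_elt[OF assms(3)] by (simp add: hom_zero)
  show ?thesis using app_add[OF assms(1) path_elt(4)[OF assms(3) 0] 0] by simp
qed

lemma app_sum:
  assumes "f \<in> cochains A B \<Phi> d" "graded_quiver A" "path A (us @ (x, (e, v), y) # zs)"
    and "\<And>q. q \<in> D \<Longrightarrow> u q \<in> hom A x y (1 + e)"
  shows "app f (us @ (x, (e, sum u D), y) # zs) = (\<Sum>q\<in>D. app f (us @ (x, (e, u q), y) # zs))"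
  using assms(4)
proof (induction D rule: infinite_finite_induct)
  case (insert q D)
  have "sum u D \<in> hom A x y (1 + e)"
    using insert.prems assms path_elt[OF assms(3)] by (auto intro: hom_sum)
  then show ?case
    using insert app_add[OF assms(1) path_elt(4)[OF assms(3)], of "u q" "sum u D"] by simp
qed (use app_zero[OF assms(1-3)] in simp_all)

lemma app_signed:
  assumes "f \<in> cochains A B \<Phi> d" "graded_quiver A" "path A (us @ (x, (e, v), y) # zs)"
  shows "app f (us @ (x, (e, signed s v), y) # zs) = signed s (app f (us @ (x, (e, v), y) # zs))"
proof -
  have v: "v \<in> hom A x y (1 + e)" using path_elt[OF assms(3)] by simp
  have m: "- v \<in> hom A x y (1 + e)"
    using path_elt[OF assms(3)] hom_scl[OF assms(2) _ _ v, of "-1"] assms by (simp add: scl_minus_one)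
  show ?thesis
    using app_zero[OF assms] app_add[OF assms(1,3) m]
    by (simp add: signed_def eq_neg_iff_add_eq_0 add.commute)
qed

section \<open>Values of cochains on blocks as paths of the target quiver\<close>

lemma hat_arrow:
  assumes "h \<in> cochains C A \<Psi> e" "\<Psi> \<in> objs C \<rightarrow> objs A" "path C ws"
  shows "hat \<Psi> (e, h) ws \<in> arrows A"
proof -
  have "ws \<noteq> []" "hd ws \<in> arrows C" "last ws \<in> arrows C" using assms(3) by (auto simp: path_def)
  then have "src (hd ws) \<in> objs C" "tgt (last ws) \<in> objs C" by (auto simp: arrows_def)
  then show ?thesis using assms app_hom[OF assms(1,3)] by (auto simp: hat_def arrows_def)
qed

lemma path_map_hat:
  assumes "h \<in> cochains C A \<Psi> e" "\<Psi> \<in> objs C \<rightarrow> objs A" "path C (concat pss)" "[] \<notin> set pss"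
  shows "path A (map (hat \<Psi> (e, h)) pss)"
  by (rule path_map[where C = C and \<pi> = id and \<Psi> = \<Psi>]) (use assms hat_arrow[OF assms(1,2)] in auto)

lemma path_insert_hat:
  assumes "m \<in> cochains A A id e" "path A (us @ ws @ zs)" "ws \<noteq> []" "path A ws"
  shows "path A (us @ hat id (e, m) ws # zs)"
  using path_replace[OF assms(2,3), of "[hat id (e, m) ws]"] hat_arrow[OF assms(1) _ assms(4)]
  by (simp add: path_single)

lemma path_middle: "path A (us @ ws @ zs) \<Longrightarrow> ws \<noteq> [] \<Longrightarrow> path A ws"
  by (auto simp: path_def successively_append_iff)

lemma path_decs:
  assumes "h \<in> cochains C A \<Psi> e" "\<Psi> \<in> objs C \<rightarrow> objs A" "path C as" "pss \<in> decs as"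
  shows "path A (map (hat \<Psi> (e, h)) pss)"
  using assms by (auto simp: decs_def intro!: path_map_hat)

lemma path_src_tgt:
  assumes "path A as"
  shows "src (hd as) \<in> objs A" "tgt (last as) \<in> objs A"
proof -
  have "hd as \<in> arrows A" "last as \<in> arrows A" using assms by (auto simp: path_def)
  then show "src (hd as) \<in> objs A" "tgt (last as) \<in> objs A" by (auto simp: arrows_def)
qed

lemma decs_ends:
  assumes "pss \<in> decs as" "as \<noteq> []"
  shows "pss \<noteq> []" "hd (hd pss) = hd as" "last (last pss) = last as"
proof -
  show ne: "pss \<noteq> []" using assms by (auto simp: decs_def)
  with assms have "hd pss \<noteq> []" "last pss \<noteq> []" "concat pss = as"
    by (auto simp: decs_def) (metis hd_in_set, metis last_in_set)
  moreover from ne have "last pss \<noteq> [] \<Longrightarrow> last (concat pss) = last (last pss)"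
    by (cases pss rule: rev_cases) auto
  ultimately show "hd (hd pss) = hd as" "last (last pss) = last as"
    using ne hd_concat[of pss] by auto
qed

text \<open>Each input lies in exactly one block, so linearity passes through \<open>h\<close> on
  that block and then through the one slot of \<open>k\<close> that receives its value.\<close>

lemma comp_cochain_in_cochains:
  assumes B: "graded_quiver B" and C: "graded_quiver C"
    and \<Phi>: "\<Phi> \<in> objs A \<rightarrow> objs B" and \<Psi>: "\<Psi> \<in> objs C \<rightarrow> objs A"
    and k: "k \<in> cochains A B \<Phi> d" and h: "h \<in> cochains C A \<Psi> 0"
  shows "comp_cochain C \<Psi> k (0, h) \<in> cochains C B (\<Phi> \<circ> \<Psi>) d"
proof (rule cochainsI)
  fix as assume p: "path C as"
  have "app k (map (hat \<Psi> (0, h)) pss) \<in>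
      hom B (\<Phi> (\<Psi> (src (hd as)))) (\<Phi> (\<Psi> (tgt (last as)))) (1 + (d + pdeg as))"
    if pss: "pss \<in> decs as" for pss
  proof -
    have "as \<noteq> []" using p by (simp add: path_def)
    from decs_ends[OF pss this] pss show ?thesis
      using app_hom[OF k path_decs[OF h \<Psi> p pss]]
      by (simp add: hd_map last_map pdeg_map_hat decs_def)
  qed
  moreover have "\<Phi> (\<Psi> (src (hd as))) \<in> objs B" "\<Phi> (\<Psi> (tgt (last as))) \<in> objs B"
    using path_src_tgt[OF p] \<Phi> \<Psi> by auto
  ultimately show "app (comp_cochain C \<Psi> k (0, h)) as \<in>
      hom B ((\<Phi> \<circ> \<Psi>) (src (hd as))) ((\<Phi> \<circ> \<Psi>) (tgt (last as))) (1 + (d + pdeg as))"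
    using B by (auto simp: app_comp[OF p] intro!: hom_sum)
next
  fix us x e v y zs
  assume p: "path C (us @ (x, (e, v), y) # zs)"
  let ?h = "hat \<Psi> (0, h)"
  \<comment> \<open>The index set does not depend on the entry \<open>v'\<close>, so linearity can
    be checked summand by summand.\<close>
  have split: "app (comp_cochain C \<Psi> k (0, h)) (us @ (x, (e, v'), y) # zs) =
      (\<Sum>(P, u, z, Z)\<in>decs_around us zs. app k (map ?h P @ ?h (u @ (x, (e, v'), y) # z) # map ?h Z))"
    if "v' \<in> hom C x y (1 + e)" for v'
    using path_elt(4)[OF p that] by (simp add: app_comp sum_decs_middle)
  \<comment> \<open>The ends and the degree of the block's value are the same for all
    \<open>v'\<close>; only its vector varies, as linearity of \<open>k\<close> in that slot
    requires.\<close>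
  have inner: "path C (u @ (x, (e, v), y) # z)"
    "\<exists>x' e' y'. (\<forall>v'. ?h (u @ (x, (e, v'), y) # z) = (x', (e', app h (u @ (x, (e, v'), y) # z)), y')) \<and>
      (\<forall>v'. v' \<in> hom C x y (1 + e) \<longrightarrow> app h (u @ (x, (e, v'), y) # z) \<in> hom A x' y' (1 + e') \<and>
         path A (map ?h P @ (x', (e', app h (u @ (x, (e, v'), y) # z)), y') # map ?h Z))"
    if "(P, u, z, Z) \<in> decs_around us zs" for P u z Z
  proof -
    have c: "concat P @ (u @ (x, (e, v'), y) # z) @ concat Z = us @ (x, (e, v'), y) # zs"
      "[] \<notin> set P" "[] \<notin> set Z" for v'
      using that by (auto simp: decs_around_def)
    show pv: "path C (u @ (x, (e, v), y) # z)"
      using p path_middle[of C "concat P" "u @ (x, (e, v), y) # z" "concat Z"] unfolding c(1) by simp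
    define x' where "x' = \<Psi> (src (hd (u @ (x, (e, v), y) # z)))"
    define y' where "y' = \<Psi> (tgt (last (u @ (x, (e, v), y) # z)))"
    define e' where "e' = pdeg u + (e + pdeg z)"
    have 1: "?h (u @ (x, (e, v'), y) # z) = (x', (e', app h (u @ (x, (e, v'), y) # z)), y')" for v'
      by (cases u; cases z rule: rev_cases) (simp_all add: hat_def x'_def y'_def e'_def)
    have 2: "app h (u @ (x, (e, v'), y) # z) \<in> hom A x' y' (1 + e') \<and>
         path A (map ?h P @ (x', (e', app h (u @ (x, (e, v'), y) # z)), y') # map ?h Z)"
      if v': "v' \<in> hom C x y (1 + e)" for v'
    proof -
      have "path C (concat (P @ (u @ (x, (e, v'), y) # z) # Z))"
        using path_elt(4)[OF p v'] c(1)[of v'] by simp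
      then have "path A (map ?h (P @ (u @ (x, (e, v'), y) # z) # Z))"
        using c(2,3) by (intro path_map_hat[OF h \<Psi>]) auto
      then have "path A (map ?h P @ (x', (e', app h (u @ (x, (e, v'), y) # z)), y') # map ?h Z)"
        by (simp add: 1)
      from this path_elt(3)[OF this] show ?thesis by simp
    qed
    show "\<exists>x' e' y'. (\<forall>v'. ?h (u @ (x, (e, v'), y) # z) = (x', (e', app h (u @ (x, (e, v'), y) # z)), y')) \<and>
      (\<forall>v'. v' \<in> hom C x y (1 + e) \<longrightarrow> app h (u @ (x, (e, v'), y) # z) \<in> hom A x' y' (1 + e') \<and>
         path A (map ?h P @ (x', (e', app h (u @ (x, (e, v'), y) # z)), y') # map ?h Z))"
      using 1 2 by blast
  qed
  note v = path_elt[OF p]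
  {
    fix w assume w: "w \<in> hom C x y (1 + e)"
    have "v + w \<in> hom C x y (1 + e)" using v w C by (simp add: hom_add)
    moreover have "app k (map ?h P @ ?h (u @ (x, (e, v + w), y) # z) # map ?h Z) =
        app k (map ?h P @ ?h (u @ (x, (e, v), y) # z) # map ?h Z) +
        app k (map ?h P @ ?h (u @ (x, (e, w), y) # z) # map ?h Z)"
      if PZ: "(P, u, z, Z) \<in> decs_around us zs" for P u z Z
      using inner(2)[OF PZ] v(3) w app_add[OF h inner(1)[OF PZ] w] by (auto simp: app_add[OF k])
    ultimately show "app (comp_cochain C \<Psi> k (0, h)) (us @ (x, (e, v + w), y) # zs) =
        app (comp_cochain C \<Psi> k (0, h)) (us @ (x, (e, v), y) # zs) +
        app (comp_cochain C \<Psi> k (0, h)) (us @ (x, (e, w), y) # zs)"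
      using v w by (auto simp: split simp flip: sum.distrib intro!: sum.cong)
  }
  fix c
  have "scl C c v \<in> hom C x y (1 + e)" using v C by (simp add: hom_scl)
  moreover have "app k (map ?h P @ ?h (u @ (x, (e, scl C c v), y) # z) # map ?h Z) =
      scl B c (app k (map ?h P @ ?h (u @ (x, (e, v), y) # z) # map ?h Z))"
    if PZ: "(P, u, z, Z) \<in> decs_around us zs" for P u z Z
    using inner(2)[OF PZ] v(3) app_scl[OF h inner(1)[OF PZ]] by (auto simp: app_scl[OF k])
  ultimately show "app (comp_cochain C \<Psi> k (0, h)) (us @ (x, (e, scl C c v), y) # zs) =
      scl B c (app (comp_cochain C \<Psi> k (0, h)) (us @ (x, (e, v), y) # zs))"
    using v B by (auto simp: split scl_sum intro!: sum.cong)
qed (simp add: comp_outside)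

section \<open>Compatibility of precomposition with the operations\<close>

text \<open>\<open>mC\<close> always acts inside a single block. Its sign from passing
  \<open>concat P @ u\<close> splits in two: the part from \<open>u\<close> belongs to the equation
  of \<open>h\<close> on the block, the part from \<open>P\<close> to the insertion of
  \<open>mA\<close> into \<open>k\<close>.\<close>

lemma gerst_comp_cochain:
  assumes A: "graded_quiver A" and \<Phi>: "\<Phi> \<in> objs A \<rightarrow> objs B"
    and k: "k \<in> cochains A B \<Phi> d"
    and mA: "mA \<in> cochains A A id 1" and mC: "mC \<in> cochains C C id 1"
    and h: "ainf_morphism C mC A mA \<Psi> h"
  shows "gerst C (comp_cochain C \<Psi> k (0, h)) (1, mC) =
    comp_cochain C \<Psi> (gerst A k (1, mA)) (0, h)"
proof (rule cochain_eqI)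
  have \<Psi>: "\<Psi> \<in> objs C \<rightarrow> objs A" and hc: "h \<in> cochains C A \<Psi> 0"
    and hm: "gerst C h (1, mC) = comp_cochain C \<Psi> mA (0, h)"
    using h by (auto simp: ainf_morphism_def)
  fix as assume p: "path C as"
  let ?h = "hat \<Psi> (0, h)" and ?mC = "hat id (1, mC)" and ?mA = "hat id (1, mA)"
  \<comment> \<open>the condition that \<open>h\<close> is an \<open>A\<^sub>\<infinity>\<close>-morphism, inserted into one slot \<open>Q\<close> of \<open>k\<close>\<close>
  have frame: "signed (pdeg (concat P)) (\<Sum>W\<in>decs Q. app k (map ?h P @ ?mA (map ?h W) # map ?h Z)) =
      (\<Sum>(u, ws, z)\<in>splits Q. signed (pdeg (concat P @ u))
         (app k (map ?h P @ ?h (u @ ?mC ws # z) # map ?h Z)))"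
    if "(P, Q, Z) \<in> frames as" for P Q Z
  proof -
    have as: "concat P @ Q @ concat Z = as" and ne: "[] \<notin> set P" "[] \<notin> set Z" "Q \<noteq> []"
      using that by (auto simp: frames_def)
    have Q: "path C Q" using p path_middle[of C "concat P" Q "concat Z"] ne as by simp
    define x where "x = \<Psi> (src (hd Q))"
    define y where "y = \<Psi> (tgt (last Q))"
    define e where "e = 1 + pdeg Q"
    have mAW: "?mA (map ?h W) = (x, (e, app mA (map ?h W)), y)" if "W \<in> decs Q" for W
      using decs_ends[OF that ne(3)] that
      by (simp add: hat_def[of id] pdeg_map_hat x_def y_def e_def hd_map last_map decs_def)
    have mCw: "?h (u @ ?mC ws # z) = (x, (e, app h (u @ ?mC ws # z)), y)"
      if "(u, ws, z) \<in> splits Q" for u ws z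
      using that by (cases u; cases z rule: rev_cases)
        (auto simp: splits_def hat_def x_def y_def e_def)
    have pQ: "path A (map ?h P @ [?h Q] @ map ?h Z)"
      using path_map_hat[OF hc \<Psi>, of "P @ Q # Z"] p as ne by auto
    \<comment> \<open>The slot has fixed ends and degree, so being a path is a condition on the
      vector alone.\<close>
    have path_x: "path A (map ?h P @ (x, (e, v), y) # map ?h Z) \<longleftrightarrow> v \<in> hom A x y (1 + e)" for v
    proof
      assume v: "v \<in> hom A x y (1 + e)"
      have "x \<in> objs A" "y \<in> objs A" using path_src_tgt[OF Q] \<Psi> by (auto simp: x_def y_def)
      then show "path A (map ?h P @ (x, (e, v), y) # map ?h Z)"
        using path_replace[OF pQ, of "[(x, (e, v), y)]"] v
        by (simp add: path_single arrows_def x_def y_def)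
    qed (rule path_elt)
    have hA: "app mA (map ?h W) \<in> hom A x y (1 + e)" if W: "W \<in> decs Q" for W
    proof -
      have "?mA (map ?h W) \<in> arrows A"
        using hat_arrow[OF mA _ path_decs[OF hc \<Psi> Q W]] by simp
      then show ?thesis by (simp add: mAW[OF W] arrows_def)
    qed
    have hC: "app h (u @ ?mC ws # z) \<in> hom A x y (1 + e)" if uwz: "(u, ws, z) \<in> splits Q" for u ws z
    proof -
      have s: "u @ ws @ z = Q" "ws \<noteq> []" using uwz by (auto simp: splits_def)
      then have "path C ws" using Q path_middle by blast
      then have "path C (u @ ?mC ws # z)" using path_insert_hat[OF mC] s Q by simp
      from hat_arrow[OF hc \<Psi> this] show ?thesis by (simp add: mCw[OF uwz] arrows_def)
    qed
    have "(\<Sum>W\<in>decs Q. app k (map ?h P @ ?mA (map ?h W) # map ?h Z)) =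
        (\<Sum>W\<in>decs Q. app k (map ?h P @ (x, (e, app mA (map ?h W)), y) # map ?h Z))"
      by (intro sum.cong refl) (simp add: mAW)
    also have "\<dots> = app k (map ?h P @ (x, (e, app (comp_cochain C \<Psi> mA (0, h)) Q), y) # map ?h Z)"
    proof -
      \<comment> \<open>The one-block decomposition \<open>[Q]\<close> supplies an entry for the
        path that \<open>app_sum\<close> asks for.\<close>
      obtain W where W: "W \<in> decs Q" using ne(3) that by (auto simp: decs_def intro: that[of "[Q]"])
      show ?thesis
        unfolding app_comp[OF Q]
        by (rule app_sum[OF k A path_x[THEN iffD2, OF hA[OF W]] hA, symmetric])
    qed
    also have "app (comp_cochain C \<Psi> mA (0, h)) Q =
        (\<Sum>t\<in>splits Q. case t of (u, ws, z) \<Rightarrow> signed (pdeg u) (app h (u @ ?mC ws # z)))"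
      by (simp add: app_gerst[OF Q] flip: hm)
    also have "app k (map ?h P @ (x, (e, \<dots>), y) # map ?h Z) =
        (\<Sum>(u, ws, z)\<in>splits Q. signed (pdeg u) (app k (map ?h P @ (x, (e, app h (u @ ?mC ws # z)), y) # map ?h Z)))"
    proof -
      have x: "x \<in> objs A" "y \<in> objs A" using path_src_tgt[OF Q] \<Psi> by (auto simp: x_def y_def)
      have s: "(case t of (u, ws, z) \<Rightarrow> signed (pdeg u) (app h (u @ ?mC ws # z))) \<in> hom A x y (1 + e)"
        if t: "t \<in> splits Q" for t
        using hC hom_signed[OF A x] t by (cases t) auto
      \<comment> \<open>Here the zero vector supplies that path.\<close>
      show ?thesis
        by (rule trans[OF app_sum[OF k A path_x[THEN iffD2, OF hom_zero[OF A x]] s]])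
          (use hC path_x in \<open>auto simp: app_signed[OF k A] intro!: sum.cong\<close>)
    qed
    finally have "(\<Sum>W\<in>decs Q. app k (map ?h P @ ?mA (map ?h W) # map ?h Z)) = \<dots>" .
    then show ?thesis
      by (simp only:) (auto simp: signed_sum mCw intro!: sum.cong)
  qed
  have "app (gerst C (comp_cochain C \<Psi> k (0, h)) (1, mC)) as =
     (\<Sum>(us, ws, zs)\<in>splits as. \<Sum>(P, u, z, Z)\<in>decs_around us zs.
        signed (pdeg (concat P @ u)) (app k (map ?h P @ ?h (u @ ?mC ws # z) # map ?h Z)))"
    unfolding app_gerst[OF p]
  proof (intro sum.cong refl, clarify)
    fix us ws zs assume "(us, ws, zs) \<in> splits as"
    then have s: "us @ ws @ zs = as" "ws \<noteq> []" by (auto simp: splits_def)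
    then have "path C ws" using p path_middle by blast
    then have "path C (us @ ?mC ws # zs)" using path_insert_hat[OF mC] s p by simp
    then show "signed (1 * pdeg us) (app (comp_cochain C \<Psi> k (0, h)) (us @ ?mC ws # zs)) =
        (\<Sum>(P, u, z, Z)\<in>decs_around us zs.
          signed (pdeg (concat P @ u)) (app k (map ?h P @ ?h (u @ ?mC ws # z) # map ?h Z)))"
      by (auto simp: app_comp sum_decs_middle signed_sum decs_around_def intro!: sum.cong)
  qed
  also have "\<dots> = (\<Sum>(P, Q, Z)\<in>frames as. \<Sum>(u, ws, z)\<in>splits Q. signed (pdeg (concat P @ u))
         (app k (map ?h P @ ?h (u @ ?mC ws # z) # map ?h Z)))"
    by (rule sum_splits_around)
  also have "\<dots> = (\<Sum>(P, Q, Z)\<in>frames as. \<Sum>W\<in>decs Q. signed (pdeg (concat P))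
      (app k (map ?h P @ ?mA (map ?h W) # map ?h Z)))"
    using frame by (intro sum.cong refl) (auto simp: signed_sum)
  also have "\<dots> = (\<Sum>pss\<in>decs as. \<Sum>(P, W, Z)\<in>splits pss. signed (pdeg (concat P))
      (app k (map ?h P @ ?mA (map ?h W) # map ?h Z)))"
    by (rule sum_decs_splits[symmetric])
  also have "\<dots> = app (comp_cochain C \<Psi> (gerst A k (1, mA)) (0, h)) as"
    unfolding app_comp[OF p]
  proof (intro sum.cong refl)
    fix pss assume "pss \<in> decs as"
    then have "path A (map ?h pss)" using path_decs[OF hc \<Psi> p] by simp
    \<comment> \<open>The inputs \<open>concat P\<close> and their images under \<open>h\<close>
      have equal degree, so this is the sign of inserting \<open>mA\<close> after
      \<open>map ?h P\<close>.\<close>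
    then show "(\<Sum>(P, W, Z)\<in>splits pss. signed (pdeg (concat P))
      (app k (map ?h P @ ?mA (map ?h W) # map ?h Z))) = app (gerst A k (1, mA)) (map ?h pss)"
      by (simp add: app_gerst sum_splits_map pdeg_map_hat case_prod_beta)
  qed
  finally show "app (gerst C (comp_cochain C \<Psi> k (0, h)) (1, mC)) as =
    app (comp_cochain C \<Psi> (gerst A k (1, mA)) (0, h)) as" .
qed (simp_all add: gerst_outside comp_outside)

text \<open>Slots are expanded from left to right, \<open>us\<close> collecting those already done.
  Index sets depend on the label of the slot, so the expansion runs over their Cartesian product
  \<open>listset\<close>.\<close>

lemma app_multilinear:
  assumes k: "k \<in> cochains A B \<Phi> d" and A: "graded_quiver A"
    and p: "path A (us @ map \<alpha> ls)"
    and \<beta>: "\<And>l q. l \<in> set ls \<Longrightarrow> q \<in> D l \<Longrightarrow> \<beta> l q \<in> arrows A \<and>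
      src (\<beta> l q) = src (\<alpha> l) \<and> tgt (\<beta> l q) = tgt (\<alpha> l) \<and> fst (elt (\<beta> l q)) = fst (elt (\<alpha> l))"
    and \<alpha>: "\<And>l. l \<in> set ls \<Longrightarrow> snd (elt (\<alpha> l)) = (\<Sum>q\<in>D l. snd (elt (\<beta> l q)))"
  shows "app k (us @ map \<alpha> ls) = (\<Sum>R\<in>listset (map D ls). app k (us @ map2 \<beta> ls R))"
  using p \<beta> \<alpha>
proof (induction ls arbitrary: us)
  case Nil
  then show ?case by simp
next
  case (Cons l ls)
  obtain x e v y where l: "\<alpha> l = (x, (e, v), y)" by (metis surj_pair)
  have v: "v = (\<Sum>q\<in>D l. snd (elt (\<beta> l q)))" using Cons.prems(3)[of l] l by simp
  have \<beta>l: "(x, (e, snd (elt (\<beta> l q))), y) = \<beta> l q" "snd (elt (\<beta> l q)) \<in> hom A x y (1 + e)"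
    if "q \<in> D l" for q
    using Cons.prems(2)[of l q] that l by (auto simp: arrows_def prod_eq_iff)
  have p: "path A (us @ (x, (e, v), y) # map \<alpha> ls)" using Cons.prems(1) l by simp
  have "app k (us @ map \<alpha> (l # ls)) = (\<Sum>q\<in>D l. app k (us @ (x, (e, snd (elt (\<beta> l q))), y) # map \<alpha> ls))"
    using app_sum[OF k A p, of "D l" "\<lambda>q. snd (elt (\<beta> l q))"] \<beta>l(2) l v by simp
  also have "\<dots> = (\<Sum>q\<in>D l. \<Sum>R\<in>listset (map D ls). app k (us @ map2 \<beta> (l # ls) (q # R)))"
  proof (intro sum.cong refl)
    fix q assume q: "q \<in> D l"
    have "path A ((us @ [\<beta> l q]) @ map \<alpha> ls)"
      using path_elt(4)[OF p \<beta>l(2)[OF q]] by (simp add: \<beta>l(1)[OF q])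
    from Cons.IH[OF this] Cons.prems(2,3)
    show "app k (us @ (x, (e, snd (elt (\<beta> l q))), y) # map \<alpha> ls) =
        (\<Sum>R\<in>listset (map D ls). app k (us @ map2 \<beta> (l # ls) (q # R)))"
      by (simp add: \<beta>l(1)[OF q])
  qed
  also have "\<dots> = (\<Sum>R\<in>listset (map D (l # ls)). app k (us @ map2 \<beta> (l # ls) R))"
  proof -
    have "listset (map D (l # ls)) = (\<lambda>(q, R). q # R) ` (D l \<times> listset (map D ls))"
      by (auto simp: set_Cons_def)
    moreover have "inj_on (\<lambda>(q, R). q # R) (D l \<times> listset (map D ls))" by (auto simp: inj_on_def)
    ultimately show ?thesis by (simp only: sum.reindex) (simp add: sum.cartesian_product case_prod_beta)
  qed
  finally show ?case .
qed

lemma length_listset: "R \<in> listset As \<Longrightarrow> length R = length As"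
  by (induction As arbitrary: R) (auto simp: set_Cons_def)

lemma listset_decs: "R \<in> listset (map decs P) \<Longrightarrow> map concat R = P"
  by (induction P arbitrary: R) (auto simp: set_Cons_def decs_def)

text \<open>Expanding every slot on the right gives a coarse decomposition with each block refined;
  on the left a fine decomposition is grouped. \<open>sum_decs_decs\<close> identifies the
  two.\<close>

lemma comp_cochain_brace:
  fixes A :: "('k::field, 'a, 'v::ab_group_add) quiver" and B :: "('k, 'b, 'w::ab_group_add) quiver"
    and C :: "('k, 'c, 'u::ab_group_add) quiver" and B' :: "('k, 'd, 'x::ab_group_add) quiver"
    and hs :: "(int \<times> ('a, 'v, 'w) cochain) list"
  assumes B: "graded_quiver B" and C: "graded_quiver C"
    and \<Phi>: "\<Phi> \<in> objs A \<rightarrow> objs B" and \<Psi>: "\<Psi> \<in> objs C \<rightarrow> objs A"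
    and m: "m \<in> cochains B B' \<Theta> d" and h: "h \<in> cochains C A \<Psi> 0"
    and hs: "\<And>e k. (e, k) \<in> set hs \<Longrightarrow> k \<in> cochains A B \<Phi> e"
  shows "comp_cochain C \<Psi> (brace A \<Phi> m hs) (0, h) =
    brace C (\<Phi> \<circ> \<Psi>) m (map (\<lambda>(e, k). (e, comp_cochain C \<Psi> k (0, h))) hs)"
proof (rule cochain_eqI)
  fix as assume p: "path C as"
  let ?h = "hat \<Psi> (0, h)" and ?c = "\<lambda>(e, k). (e, comp_cochain C \<Psi> k (0, h))"
  \<comment> \<open>A label pairs a cochain of the brace with its block; \<open>W\<close> is one
    decomposition of that block.\<close>
  define \<beta> where "\<beta> = (\<lambda>(ek :: int \<times> ('a, 'v, 'w) cochain, l :: ('c, 'u) arrow list) W. hat \<Phi> ek (map ?h W))"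
  have expand: "app m (map2 (hat (\<Phi> \<circ> \<Psi>)) (map ?c hs) P) =
      (\<Sum>R\<in>listset (map decs P). app m (map2 (hat \<Phi>) hs (map (map ?h) R)))"
    if P: "P \<in> decs as" and len: "length P = length hs" for P
  proof -
    let ?\<alpha> = "\<lambda>(ek, l). hat (\<Phi> \<circ> \<Psi>) (?c ek) l"
    have ne: "[] \<notin> set P" and c: "concat P = as" using P by (auto simp: decs_def)
    have path: "path C l" if "l \<in> set P" for l
      using that p path_middle[of C _ l] ne c by (metis concat.simps(2) concat_append split_list)
    have "map ?\<alpha> (zip hs P) = map2 (hat (\<Phi> \<circ> \<Psi>)) (map ?c hs) P"
      by (auto simp: zip_map1 case_prod_beta)
    then have "app m (map2 (hat (\<Phi> \<circ> \<Psi>)) (map ?c hs) P) = app m ([] @ map ?\<alpha> (zip hs P))"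
      by simp
    also have "\<dots> = (\<Sum>R\<in>listset (map (decs \<circ> snd) (zip hs P)). app m ([] @ map2 \<beta> (zip hs P) R))"
    proof (rule app_multilinear[OF m B])
      have "path B (map ?\<alpha> (zip hs P))"
      proof (rule path_map[where C = C and \<pi> = snd and \<Psi> = "\<Phi> \<circ> \<Psi>"])
        fix l assume l: "l \<in> set (zip hs P)" and pl: "path C (snd l)"
        obtain e k ws where ekw: "l = ((e, k), ws)" by (metis surj_pair)
        then have "k \<in> cochains A B \<Phi> e" using l hs by (auto dest: set_zip_leftD)
        from comp_cochain_in_cochains[OF B C \<Phi> \<Psi> this h]
        have "hat (\<Phi> \<circ> \<Psi>) (e, comp_cochain C \<Psi> k (0, h)) ws \<in> arrows B"
          using pl \<Phi> \<Psi> ekw by (intro hat_arrow) auto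
        then show "?\<alpha> l \<in> arrows B \<and> src (?\<alpha> l) = (\<Phi> \<circ> \<Psi>) (src (hd (snd l))) \<and>
            tgt (?\<alpha> l) = (\<Phi> \<circ> \<Psi>) (tgt (last (snd l)))"
          by (simp add: ekw)
      next
        show "path C (concat (map snd (zip hs P)))" using len c p by simp
        show "snd l \<noteq> []" if "l \<in> set (zip hs P)" for l
          using that ne by (metis prod.collapse set_zip_rightD)
      qed
      then show "path B ([] @ map ?\<alpha> (zip hs P))" by simp
    next
      fix l assume l: "l \<in> set (zip hs P)"
      obtain e k ws where ekw: "l = ((e, k), ws)" by (metis surj_pair)
      have k: "k \<in> cochains A B \<Phi> e" and ws: "path C ws" "ws \<noteq> []"
        using l hs ekw path ne by (auto dest: set_zip_leftD set_zip_rightD)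
      show "snd (elt (?\<alpha> l)) = (\<Sum>q\<in>(decs \<circ> snd) l. snd (elt (\<beta> l q)))"
        by (simp add: ekw \<beta>_def elt_hat app_comp[OF ws(1)])
      fix q assume q: "q \<in> (decs \<circ> snd) l"
      then have q': "q \<in> decs ws" by (simp add: ekw)
      have "hat \<Phi> (e, k) (map ?h q) \<in> arrows B"
        by (rule hat_arrow[OF k \<Phi> path_decs[OF h \<Psi> ws(1) q']])
      then show "\<beta> l q \<in> arrows B \<and> src (\<beta> l q) = src (?\<alpha> l) \<and>
          tgt (\<beta> l q) = tgt (?\<alpha> l) \<and> fst (elt (\<beta> l q)) = fst (elt (?\<alpha> l))"
        using decs_ends[OF q' ws(2)] q'
        by (simp add: ekw \<beta>_def elt_hat hd_map last_map pdeg_map_hat decs_def)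
    qed
    also have "map (decs \<circ> snd) (zip hs P) = map decs P"
      using len by (simp flip: map_map)
    also have "(\<Sum>R\<in>listset (map decs P). app m ([] @ map2 \<beta> (zip hs P) R)) =
        (\<Sum>R\<in>listset (map decs P). app m (map2 (hat \<Phi>) hs (map (map ?h) R)))"
    proof (intro sum.cong refl)
      fix R assume "R \<in> listset (map decs P)"
      then have "length R = length P" by (simp add: length_listset)
      then have "map2 \<beta> (zip hs P) R = map2 (hat \<Phi>) hs (map (map ?h) R)"
        using len by (intro nth_equalityI) (simp_all add: \<beta>_def case_prod_beta)
      then show "app m ([] @ map2 \<beta> (zip hs P) R) = app m (map2 (hat \<Phi>) hs (map (map ?h) R))"
        by simp
    qed
    finally show ?thesis .
  qed
  have deg: "brace_deg hs (map (map ?h) R) = brace_deg (map ?c hs) (map concat R)"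
    if "length R = length hs" for R :: "('c, 'u) arrow list list list"
  proof -
    have "pdeg (concat (take j (map (map ?h) R))) = pdeg (concat (take j (map concat R)))" for j
      using pdeg_map_hat[of \<Psi> h "concat (take j R)"]
      by (simp add: take_map map_concat[symmetric] concat_concat)
    then show ?thesis by (simp add: brace_deg_def case_prod_beta)
  qed
  have "app (comp_cochain C \<Psi> (brace A \<Phi> m hs) (0, h)) as =
      (\<Sum>pss\<in>decs as. \<Sum>R\<in>{R\<in>decs pss. length R = length hs}.
        signed (brace_deg hs (map (map ?h) R)) (app m (map2 (hat \<Phi>) hs (map (map ?h) R))))"
    unfolding app_comp[OF p]
  proof (intro sum.cong refl)
    fix pss assume pss: "pss \<in> decs as"
    let ?G = "\<lambda>Q. signed (brace_deg hs Q) (app m (map2 (hat \<Phi>) hs Q))"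
    \<comment> \<open>The length restriction becomes a conditional because
      \<open>sum_decs_map\<close> transports sums over all decompositions.\<close>
    have "app (brace A \<Phi> m hs) (map ?h pss) =
        (\<Sum>Q\<in>decs (map ?h pss). if length Q = length hs then ?G Q else 0)"
      unfolding app_brace[OF path_decs[OF h \<Psi> p pss]] by (rule sum.inter_filter) simp
    also have "\<dots> = (\<Sum>R\<in>decs pss. if length R = length hs then ?G (map (map ?h) R) else 0)"
      by (simp add: sum_decs_map)
    also have "\<dots> = (\<Sum>R\<in>{R\<in>decs pss. length R = length hs}. ?G (map (map ?h) R))"
      by (rule sum.inter_filter[symmetric]) simp
    finally show "app (brace A \<Phi> m hs) (map ?h pss) =
      (\<Sum>R\<in>{R\<in>decs pss. length R = length hs}. ?G (map (map ?h) R))" .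
  qed
  also have "\<dots> = (\<Sum>P\<in>{P\<in>decs as. length P = length hs}. \<Sum>R\<in>listset (map decs P).
        signed (brace_deg hs (map (map ?h) R)) (app m (map2 (hat \<Phi>) hs (map (map ?h) R))))"
    by (rule sum_decs_decs)
  also have "\<dots> = (\<Sum>P\<in>{P\<in>decs as. length P = length hs}.
        signed (brace_deg (map ?c hs) P) (app m (map2 (hat (\<Phi> \<circ> \<Psi>)) (map ?c hs) P)))"
  proof (intro sum.cong refl)
    fix P assume P: "P \<in> {P\<in>decs as. length P = length hs}"
    have "brace_deg hs (map (map ?h) R) = brace_deg (map ?c hs) P" if "R \<in> listset (map decs P)" for R
      using deg[of R] listset_decs[OF that] length_listset[OF that] P by simp
    then show "(\<Sum>R\<in>listset (map decs P).
          signed (brace_deg hs (map (map ?h) R)) (app m (map2 (hat \<Phi>) hs (map (map ?h) R)))) =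
        signed (brace_deg (map ?c hs) P) (app m (map2 (hat (\<Phi> \<circ> \<Psi>)) (map ?c hs) P))"
      using P expand[of P] by (simp add: signed_sum)
  qed
  also have "\<dots> = app (brace C (\<Phi> \<circ> \<Psi>) m (map ?c hs)) as"
    by (simp add: app_brace[OF p])
  finally show "app (comp_cochain C \<Psi> (brace A \<Phi> m hs) (0, h)) as =
    app (brace C (\<Phi> \<circ> \<Psi>) m (map ?c hs)) as" .
qed (simp_all add: brace_outside comp_outside)

section \<open>Precomposing a homotopy\<close>

lemma app_plus: "app (k + k') as = app k as + app k' as"
  and app_0: "app 0 as = 0"
  by (simp_all add: app_def)

lemma comp_cochain_add:
  "comp_cochain C \<Psi> (k + k') (0, h) = comp_cochain C \<Psi> k (0, h) + comp_cochain C \<Psi> k' (0, h)"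
  by (rule cochain_eqI[where A = C])
    (simp_all add: comp_outside app_comp app_plus sum.distrib)

text \<open>Composition is a finite sum of values of the outer cochain, so linearity in it is an
  exchange of sums.\<close>

lemma comp_cochain_linear:
  assumes "graded_quiver B"
  shows "comp_cochain C \<Psi> (\<lambda>xs vs. \<Sum>i\<in>I. scl B (c i) (k i xs vs)) (0, h) =
    (\<lambda>xs vs. \<Sum>i\<in>I. scl B (c i) (comp_cochain C \<Psi> (k i) (0, h) xs vs))"
proof (rule cochain_eqI[where A = C])
  fix as assume p: "path C as"
  have *: "app (\<lambda>xs vs. \<Sum>i\<in>I. scl B (c i) (F i xs vs)) bs = (\<Sum>i\<in>I. scl B (c i) (app (F i) bs))"
    for F bs by (simp add: app_def)
  show "app (comp_cochain C \<Psi> (\<lambda>xs vs. \<Sum>i\<in>I. scl B (c i) (k i xs vs)) (0, h)) as =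
      app (\<lambda>xs vs. \<Sum>i\<in>I. scl B (c i) (comp_cochain C \<Psi> (k i) (0, h) xs vs)) as"
    unfolding * app_comp[OF p] scl_sum[OF assms] by (rule sum.swap)
qed (simp_all add: comp_outside scl_zero[OF assms])

text \<open>Inside \<^const>\<open>comp_cochain\<close> the sum is truncated at the number of pieces, which may be smaller
  than the number of inputs; the terms in between vanish.\<close>

lemma comp_cochain_sum_arity:
  assumes h: "h \<in> cochains C A \<Psi> 0" and \<Psi>: "\<Psi> \<in> objs C \<rightarrow> objs A"
    and G: "\<And>r xs vs. length vs < r \<Longrightarrow> G r xs vs = 0"
  shows "comp_cochain C \<Psi> (\<lambda>xs vs. \<Sum>r=1..length vs. G r xs vs) (0, h) =
    (\<lambda>xs vs. \<Sum>r=1..length vs. comp_cochain C \<Psi> (G r) (0, h) xs vs)"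
proof (rule cochain_eqI[where A = C])
  fix as assume p: "path C as"
  have *: "app (\<lambda>xs vs. \<Sum>r=1..length vs. F r xs vs) bs = (\<Sum>r=1..length bs. app (F r) bs)" for F bs
    by (simp add: app_def)
  have "app (comp_cochain C \<Psi> (\<lambda>xs vs. \<Sum>r=1..length vs. G r xs vs) (0, h)) as =
      (\<Sum>pss\<in>decs as. \<Sum>r=1..length as. app (G r) (map (hat \<Psi> (0, h)) pss))"
    unfolding * app_comp[OF p]
  proof (rule sum.cong[OF refl])
    fix pss assume "pss \<in> decs as"
    then have "length pss \<le> length as" by (rule length_decs)
    then show "(\<Sum>r=1..length (map (hat \<Psi> (0, h)) pss). app (G r) (map (hat \<Psi> (0, h)) pss)) =
        (\<Sum>r=1..length as. app (G r) (map (hat \<Psi> (0, h)) pss))"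
      by (intro sum.mono_neutral_left) (auto simp: app_def G)
  qed
  also have "\<dots> = app (\<lambda>xs vs. \<Sum>r=1..length vs. comp_cochain C \<Psi> (G r) (0, h) xs vs) as"
    unfolding * app_comp[OF p] by (rule sum.swap)
  finally show "app (comp_cochain C \<Psi> (\<lambda>xs vs. \<Sum>r=1..length vs. G r xs vs) (0, h)) as =
      app (\<lambda>xs vs. \<Sum>r=1..length vs. comp_cochain C \<Psi> (G r) (0, h) xs vs) as" .
qed (simp_all add: comp_outside)

text \<open>What \<open>coeff_map_poly\<close> asks of a map applied to coefficients.\<close>

lemma comp_cochain_zero: "comp_cochain C \<Psi> 0 (0, h) = 0"
  by (rule cochain_eqI[where A = C]) (simp_all add: comp_outside app_comp app_0)

lemma comp_cochain_sum: "comp_cochain C \<Psi> (\<lambda>xs vs. \<Sum>j\<in>J. G j xs vs) (0, h) =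
    (\<lambda>xs vs. \<Sum>j\<in>J. comp_cochain C \<Psi> (G j) (0, h) xs vs)"
proof (rule cochain_eqI[where A = C])
  fix as assume p: "path C as"
  have *: "app (\<lambda>xs vs. \<Sum>j\<in>J. F j xs vs) bs = (\<Sum>j\<in>J. app (F j) bs)" for F bs
    by (simp add: app_def)
  show "app (comp_cochain C \<Psi> (\<lambda>xs vs. \<Sum>j\<in>J. G j xs vs) (0, h)) as =
      app (\<lambda>xs vs. \<Sum>j\<in>J. comp_cochain C \<Psi> (G j) (0, h) xs vs) as"
    unfolding * app_comp[OF p] by (rule sum.swap)
qed (simp_all add: comp_outside)

text \<open>Strictly increasing naturals starting at 0 satisfy
  \<open>j \<le> ps ! j\<close>.\<close>

lemma cuts_empty: "n < r \<Longrightarrow> cuts n r = {}"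
proof (rule ccontr)
  assume n: "n < r" and "cuts n r \<noteq> {}"
  then obtain ps where ps: "ps \<in> cuts n r" by blast
  have "j \<le> ps ! j" if "j \<le> r" for j
    using that cuts_D(4)[OF ps] by (induction j) (auto simp: Suc_le_eq intro: le_less_trans)
  from this[of r] cuts_D(3)[OF ps] n show False by simp
qed

lemma brace_arity: "length vs < length hs \<Longrightarrow> brace C \<Psi> k hs xs vs = 0"
  by (simp add: brace_def cuts_empty)

text \<open>For \<open>a\<close> this is part of \<open>homotopic\<close>; for \<open>b\<close> it
  has to be derived from the coefficients.\<close>

lemma eval_poly_in_cochains:
  assumes A: "graded_quiver A" and B: "graded_quiver B" and \<Phi>: "\<Phi> \<in> objs A \<rightarrow> objs B"
    and p: "p \<in> polys (cochains A B \<Phi> d)"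
  shows "eval_poly B p t \<in> cochains A B \<Phi> d"
proof -
  have c: "coeff p i \<in> cochains A B \<Phi> d" for i using p by (simp add: polys_def)
  have *: "app (eval_poly B p t) as = (\<Sum>i\<le>degree p. scl B (t ^ i) (app (coeff p i) as))" for as
    by (simp add: app_def eval_poly_def)
  show ?thesis
  proof (rule cochainsI)
    fix as assume as: "path A as"
    have "\<Phi> (src (hd as)) \<in> objs B" "\<Phi> (tgt (last as)) \<in> objs B" using path_src_tgt[OF as] \<Phi> by auto
    then show "app (eval_poly B p t) as \<in> hom B (\<Phi> (src (hd as))) (\<Phi> (tgt (last as))) (1 + (d + pdeg as))"
      unfolding * by (intro hom_sum[OF B] hom_scl[OF B] app_hom[OF c as])
  qed (simp_all add: * app_add[OF c] app_scl[OF c] scl_add[OF B] sum.distrib scl_sum[OF B] scl_scl[OF B]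
         mult.commute, simp add: eval_poly_def cochains_outside[OF c] scl_zero[OF B])
qed

text \<open>Precomposition may kill the leading coefficient, so values before and after are compared
  over a common range of exponents.\<close>

lemma
  assumes "graded_quiver B" "degree p \<le> n"
  shows eval_poly_bound: "eval_poly B p t = (\<lambda>xs vs. \<Sum>i\<le>n. scl B (t ^ i) (coeff p i xs vs))"
    and eval_deriv_bound: "eval_deriv B p t =
      (\<lambda>xs vs. \<Sum>i<n. scl B (of_nat (Suc i) * t ^ i) (coeff p (Suc i) xs vs))"
proof -
  show "eval_poly B p t = (\<lambda>xs vs. \<Sum>i\<le>n. scl B (t ^ i) (coeff p i xs vs))"
    unfolding eval_poly_def using assms
    by (intro ext sum.mono_neutral_left) (auto simp: coeff_eq_0 scl_zero[OF assms(1)])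
  show "eval_deriv B p t = (\<lambda>xs vs. \<Sum>i<n. scl B (of_nat (Suc i) * t ^ i) (coeff p (Suc i) xs vs))"
    unfolding eval_deriv_def using assms
    by (intro ext sum.mono_neutral_left) (auto simp: coeff_eq_0 scl_zero[OF assms(1)])
qed

lemma
  fixes p :: "('a, 'v::ab_group_add, 'w::ab_group_add) cochain poly"
    and C :: "('k, 'c, 'u::ab_group_add) quiver" and \<Psi> :: "'c \<Rightarrow> 'a"
    and h :: "('c, 'u, 'v) cochain"
  assumes "graded_quiver B"
  defines "q \<equiv> map_poly (\<lambda>k. comp_cochain C \<Psi> k (0, h)) p"
  shows eval_poly_comp: "eval_poly B q t = comp_cochain C \<Psi> (eval_poly B p t) (0, h)"
    and eval_deriv_comp: "eval_deriv B q t = comp_cochain C \<Psi> (eval_deriv B p t) (0, h)"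
proof -
  have c: "coeff q i = comp_cochain C \<Psi> (coeff p i) (0, h)" for i
    unfolding q_def by (simp add: coeff_map_poly comp_cochain_zero)
  have d: "degree q \<le> degree p"
    by (rule degree_le) (simp add: c coeff_eq_0 comp_cochain_zero)
  show "eval_poly B q t = comp_cochain C \<Psi> (eval_poly B p t) (0, h)"
    unfolding eval_poly_bound[OF assms(1) d] c
    unfolding eval_poly_def comp_cochain_linear[OF assms(1)] ..
  show "eval_deriv B q t = comp_cochain C \<Psi> (eval_deriv B p t) (0, h)"
    unfolding eval_deriv_bound[OF assms(1) d] c
    unfolding eval_deriv_def comp_cochain_linear[OF assms(1)] ..
qed

text \<open>Chaining the two morphism equations leaves the associativity of \<open>mB\<close>,
  \<open>f\<close> and \<open>h\<close>, obtained arity by arity from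
  \<open>comp_cochain_brace\<close> for constant lists.\<close>

lemma ainf_morphism_comp:
  assumes A: "ainf_category A mA" and B: "ainf_category B mB" and C: "ainf_category C mC"
    and f: "ainf_morphism A mA B mB \<Phi> f" and h: "ainf_morphism C mC A mA \<Psi> h"
  shows "ainf_morphism C mC B mB (\<Phi> \<circ> \<Psi>) (comp_cochain C \<Psi> f (0, h))"
proof -
  have \<Phi>: "\<Phi> \<in> objs A \<rightarrow> objs B" and \<Psi>: "\<Psi> \<in> objs C \<rightarrow> objs A"
    and fc: "f \<in> cochains A B \<Phi> 0" and hc: "h \<in> cochains C A \<Psi> 0"
    and fm: "gerst A f (1, mA) = comp_cochain A \<Phi> mB (0, f)"
    using f h by (auto simp: ainf_morphism_def)
  have gA: "graded_quiver A" and gB: "graded_quiver B" and gC: "graded_quiver C"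
    and m: "mA \<in> cochains A A id 1" "mB \<in> cochains B B id 1" "mC \<in> cochains C C id 1"
    using A B C by (auto simp: ainf_category_def)
  let ?f = "comp_cochain C \<Psi> f (0, h)"
  have "gerst C ?f (1, mC) = comp_cochain C \<Psi> (comp_cochain A \<Phi> mB (0, f)) (0, h)"
    using gerst_comp_cochain[OF gA \<Phi> fc m(1,3) h] fm by simp
  also have "comp_cochain A \<Phi> mB (0, f) = (\<lambda>xs vs. \<Sum>r=1..length vs. brace A \<Phi> mB (replicate r (0, f)) xs vs)"
    by (simp add: comp_cochain_def)
  also have "comp_cochain C \<Psi> \<dots> (0, h) =
      (\<lambda>xs vs. \<Sum>r=1..length vs. comp_cochain C \<Psi> (brace A \<Phi> mB (replicate r (0, f))) (0, h) xs vs)"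
    by (rule comp_cochain_sum_arity[OF hc \<Psi>]) (simp add: brace_arity)
  also have "\<dots> = (\<lambda>xs vs. \<Sum>r=1..length vs. brace C (\<Phi> \<circ> \<Psi>) mB (replicate r (0, ?f)) xs vs)"
  proof -
    have "comp_cochain C \<Psi> (brace A \<Phi> mB (replicate r (0, f))) (0, h) =
        brace C (\<Phi> \<circ> \<Psi>) mB (replicate r (0, ?f))" for r
      using comp_cochain_brace[OF gB gC \<Phi> \<Psi> m(2) hc, of "replicate r (0, f)"] fc by auto
    then show ?thesis by (simp only:)
  qed
  finally have "gerst C ?f (1, mC) = comp_cochain C (\<Phi> \<circ> \<Psi>) mB (0, ?f)"
    by (simp add: comp_cochain_def[of C "\<Phi> \<circ> \<Psi>"])
  moreover have "\<Phi> \<circ> \<Psi> \<in> objs C \<rightarrow> objs B" using \<Phi> \<Psi> by auto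
  ultimately show ?thesis
    using comp_cochain_in_cochains[OF gB gC \<Phi> \<Psi> fc hc] by (simp add: ainf_morphism_def)
qed

theorem proposition4p10:
  fixes A :: "('k::field, 'a, 'v::ab_group_add) quiver"
    and B :: "('k, 'b, 'w::ab_group_add) quiver"
    and C :: "('k, 'c, 'u::ab_group_add) quiver"
    and \<Phi> :: "'a \<Rightarrow> 'b" and \<Psi> :: "'c \<Rightarrow> 'a"
    and mA :: "('a, 'v, 'v) cochain" and mB :: "('b, 'w, 'w) cochain"
    and mC :: "('c, 'u, 'u) cochain"
    and f g :: "('a, 'v, 'w) cochain" and h :: "('c, 'u, 'v) cochain"
  assumes char: "CHAR('k) \<noteq> 2" "CHAR('k) \<noteq> 3"
    and A: "ainf_category A mA" and B: "ainf_category B mB" and C: "ainf_category C mC"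
    and fg: "homotopic A mA B mB \<Phi> f g"
    and h: "ainf_morphism C mC A mA \<Psi> h"
  shows "homotopic C mC B mB (\<Phi> \<circ> \<Psi>)
           (comp_cochain C \<Psi> f (0, h)) (comp_cochain C \<Psi> g (0, h))"
proof -
  let ?c = "\<lambda>k. comp_cochain C \<Psi> k (0, h)"
  have gA: "graded_quiver A" and gB: "graded_quiver B" and gC: "graded_quiver C"
    and m: "mA \<in> cochains A A id 1" "mB \<in> cochains B B id 1" "mC \<in> cochains C C id 1"
    using A B C by (auto simp: ainf_category_def)
  have f: "ainf_morphism A mA B mB \<Phi> f" and g: "ainf_morphism A mA B mB \<Phi> g"
    using fg by (simp_all add: homotopic_def)
  have \<Phi>: "\<Phi> \<in> objs A \<rightarrow> objs B" and \<Psi>: "\<Psi> \<in> objs C \<rightarrow> objs A" and hc: "h \<in> cochains C A \<Psi> 0"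
    using f h by (auto simp: ainf_morphism_def)
  obtain a b where a: "a \<in> polys (cochains A B \<Phi> 0)" and b: "b \<in> polys (cochains A B \<Phi> (-1))"
    and a01: "eval_poly B a 0 = f" "eval_poly B a 1 = g"
    and am: "\<And>t. ainf_morphism A mA B mB \<Phi> (eval_poly B a t)"
    and ab: "\<And>t. eval_deriv B a t =
           (\<lambda>xs vs. \<Sum>r=1..length vs. \<Sum>j=1..r.
              brace A \<Phi> mB
                (replicate (j - 1) (0, eval_poly B a t) @ [(-1, eval_poly B b t)] @
                 replicate (r - j) (0, eval_poly B a t)) xs vs) +
           gerst A (eval_poly B b t) (1, mA)"
    using fg unfolding homotopic_def by blast
  let ?a = "map_poly ?c a" and ?b = "map_poly ?c b"
  have polys: "map_poly ?c p \<in> polys (cochains C B (\<Phi> \<circ> \<Psi>) d)" if "p \<in> polys (cochains A B \<Phi> d)" for p d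
    using that comp_cochain_in_cochains[OF gB gC \<Phi> \<Psi> _ hc]
    by (simp add: polys_def coeff_map_poly comp_cochain_zero)
  have deriv: "eval_deriv B ?a t =
           (\<lambda>xs vs. \<Sum>r=1..length vs. \<Sum>j=1..r.
              brace C (\<Phi> \<circ> \<Psi>) mB
                (replicate (j - 1) (0, eval_poly B ?a t) @ [(-1, eval_poly B ?b t)] @
                 replicate (r - j) (0, eval_poly B ?a t)) xs vs) +
           gerst C (eval_poly B ?b t) (1, mC)" for t
  proof -
    let ?at = "eval_poly B a t" and ?bt = "eval_poly B b t"
    let ?hs = "\<lambda>r j. replicate (j - 1) (0, ?at) @ [(-1, ?bt)] @ replicate (r - j) (0, ?at)"
    have at: "?at \<in> cochains A B \<Phi> 0" and bt: "?bt \<in> cochains A B \<Phi> (-1)"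
      using eval_poly_in_cochains[OF gA gB \<Phi>] a b by auto
    \<comment> \<open>The range of r depends on the number of inputs, which composition changes; the
      range of j does not.\<close>
    have "?c (\<lambda>xs vs. \<Sum>r=1..length vs. \<Sum>j=1..r. brace A \<Phi> mB (?hs r j) xs vs) =
        (\<lambda>xs vs. \<Sum>r=1..length vs. ?c (\<lambda>xs vs. \<Sum>j=1..r. brace A \<Phi> mB (?hs r j) xs vs) xs vs)"
      by (rule comp_cochain_sum_arity[OF hc \<Psi>]) (auto intro!: sum.neutral brace_arity)
    also have "\<dots> = (\<lambda>xs vs. \<Sum>r=1..length vs. \<Sum>j=1..r. ?c (brace A \<Phi> mB (?hs r j)) xs vs)"
      unfolding comp_cochain_sum ..
    also have "\<dots> = (\<lambda>xs vs. \<Sum>r=1..length vs. \<Sum>j=1..r. brace C (\<Phi> \<circ> \<Psi>) mB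
        (replicate (j - 1) (0, ?c ?at) @ [(-1, ?c ?bt)] @ replicate (r - j) (0, ?c ?at)) xs vs)"
    proof -
      \<comment> \<open>The recorded degrees 0 and -1 survive composition with \<open>h\<close>, so
        \<open>b\<close> keeps its position and its sign.\<close>
      have "?c (brace A \<Phi> mB (?hs r j)) = brace C (\<Phi> \<circ> \<Psi>) mB
        (replicate (j - 1) (0, ?c ?at) @ [(-1, ?c ?bt)] @ replicate (r - j) (0, ?c ?at))" for r j
        using comp_cochain_brace[OF gB gC \<Phi> \<Psi> m(2) hc, of "?hs r j"] at bt
        by (auto simp: in_set_replicate)
      then show ?thesis by (simp only:)
    qed
    finally show ?thesis
      using gerst_comp_cochain[OF gA \<Phi> bt m(1,3) h]
      unfolding eval_deriv_comp[OF gB] eval_poly_comp[OF gB] ab comp_cochain_add by (simp only:)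
  qed
  show ?thesis
    unfolding homotopic_def
  proof (intro conjI)
    show "ainf_morphism C mC B mB (\<Phi> \<circ> \<Psi>) (?c f)" "ainf_morphism C mC B mB (\<Phi> \<circ> \<Psi>) (?c g)"
      by (rule ainf_morphism_comp[OF A B C f h], rule ainf_morphism_comp[OF A B C g h])
    have "eval_poly B ?a 0 = ?c f" "eval_poly B ?a 1 = ?c g"
      by (simp_all add: eval_poly_comp[OF gB] a01)
    moreover have "ainf_morphism C mC B mB (\<Phi> \<circ> \<Psi>) (eval_poly B ?a t)" for t
      unfolding eval_poly_comp[OF gB] by (rule ainf_morphism_comp[OF A B C am h])
    ultimately show "\<exists>a\<in>polys (cochains C B (\<Phi> \<circ> \<Psi>) 0). \<exists>b\<in>polys (cochains C B (\<Phi> \<circ> \<Psi>) (-1)).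
        eval_poly B a 0 = ?c f \<and> eval_poly B a 1 = ?c g \<and>
        (\<forall>t. ainf_morphism C mC B mB (\<Phi> \<circ> \<Psi>) (eval_poly B a t)) \<and>
        (\<forall>t. eval_deriv B a t =
           (\<lambda>xs vs. \<Sum>r=1..length vs. \<Sum>j=1..r.
              brace C (\<Phi> \<circ> \<Psi>) mB
                (replicate (j - 1) (0, eval_poly B a t) @ [(-1, eval_poly B b t)] @
                 replicate (r - j) (0, eval_poly B a t)) xs vs) +
           gerst C (eval_poly B b t) (1, mC))"
      using deriv polys[OF a] polys[OF b] by blast
  qed
qed

end
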